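(* Let $X$ be a complex manifold of dimension $n$, $(E,h)$ a Hermitian holomorphic vector bundle over $X$ with Chern connection $\nabla=\nabla'+\overline\partial$, and let $\phi\in A^{0,1}(X,T^{1,0}_X)$. Then on the space $A^{\bullet,\bullet}(X,E)$, $$e^{-i_\phi}\circ\nabla\circ e^{i_\phi}=\nabla-\mathcal L_\phi-i_{\frac12[\phi,\phi]}=\nabla-\mathcal L^{1,0}_\phi+i_{\overline\partial\phi-\frac12[\phi,\phi]} .$$ In particular, if $\sigma\in A^{n,\bullet}(X,E)$ and $\phi$ is integrable, i.e. $\overline\partial\phi-\frac12[\phi,\phi]=0$, then $$\left(e^{-i_\phi}\circ\nabla\circ e^{i_\phi}\right)(\sigma)=\overline\partial\sigma+\nabla'(\phi\lrcorner\sigma).$$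
   Context: $A^{p,q}(X,E)$ is the space of smooth $E$-valued $(p,q)$-forms, $A^{0,q}(X,T^{1,0}_X)$ the space of smooth $(0,q)$-forms with values in the holomorphic tangent bundle, and $\nabla'$ the $(1,0)$-part of the Chern connection. Contraction: for $\phi\in A^{0,s}(X,T^{1,0}_X)$, $i_\phi=\phi\lrcorner:A^{p,q}(X,E)\to A^{p-1,q+s}(X,E)$ is the operator determined by $i_{\eta\otimes Y}(\alpha)=\eta\wedge(i_Y\alpha)$ for $\eta\in A^{0,s}(X)$ and $Y$ a $(1,0)$-vector field, $i_Y$ being insertion of $Y$ in the first slot. For $\phi\in A^{0,1}(X,T^{1,0}_X)$, $e^{i_\phi}=\sum_{k\ge0}\frac1{k!}i_\phi^k$ (a finite sum). Lie derivative: for $\phi\in A^{0,1}(X,T^{1,0}_X)$, $\mathcal L_\phi=-\nabla\circ i_\phi+i_\phi\circ\nabla=\mathcal L^{1,0}_\phi+\mathcal L^{0,1}_\phi$, where $\mathcal L^{1,0}_\phi=-\nabla'\circ i_\phi+i_\phi\circ\nabla'$ and $\mathcal L^{0,1}_\phi=-\overline\partial\circ i_\phi+i_\phi\circ\overline\partial$. Bracket: for $\varphi=\sum_i\varphi^i\otimes\partial_i$ and $\psi=\sum_j\psi^j\otimes\partial_j$ in $A^{0,1}(X,T^{1,0}_X)$ (local holomorphic coordinates), $[\varphi,\psi]=\sum_{i,j}(\varphi^i\wedge\partial_i\psi^j+\psi^i\wedge\partial_i\varphi^j)\otimes\partial_j$, where $\partial_i$ acts on the coefficients of the $(0,1)$-forms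 $\varphi^j,\psi^j$. *)

theory Defs
  imports "HOL-Analysis.Analysis" "HOL-Library.Function_Algebras"
begin

section \<open>Smooth and holomorphic functions on open subsets of \<open>\<complex>\<^sup>n\<close>\<close>

text \<open>\<open>ck_on k f S\<close> is used for open \<open>S\<close> in a finite-dimensional space only.\<close>

primrec ck_on :: "nat \<Rightarrow> ('a::real_normed_vector \<Rightarrow> 'b::real_normed_vector) \<Rightarrow> 'a set \<Rightarrow> bool" where
  "ck_on 0 f S \<longleftrightarrow> continuous_on S f"
| "ck_on (Suc k) f S \<longleftrightarrow> (\<forall>x\<in>S. f differentiable (at x)) \<and>
     (\<forall>v. ck_on k (\<lambda>x. frechet_derivative f (at x) v) S)"

definition smooth_on :: "'a set \<Rightarrow> ('a::real_normed_vector \<Rightarrow> 'b::real_normed_vector) \<Rightarrow> bool" where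
  "smooth_on S f \<longleftrightarrow> (\<forall>k. ck_on k f S)"

definition holo_on :: "(complex^'n::finite) set \<Rightarrow> (complex^'n \<Rightarrow> complex) \<Rightarrow> bool" where
  "holo_on S f \<longleftrightarrow> (\<forall>z\<in>S. \<exists>D. (f has_derivative D) (at z) \<and> (\<forall>a v. D (a *s v) = a * D v))"

section \<open>Complex manifolds\<close>

text \<open>A chart is a pair of its domain and its coordinate map; the manifold is the whole type \<open>'x\<close>.\<close>

type_synonym ('x, 'n) chart = "'x set \<times> ('x \<Rightarrow> complex^'n)"

definition chart_inv :: "('x, 'n::finite) chart \<Rightarrow> complex^'n \<Rightarrow> 'x" where
  "chart_inv c = inv_into (fst c) (snd c)"

definition complex_manifold :: "('x::{t2_space,second_countable_topology}, 'n::finite) chart set \<Rightarrow> bool" where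
  "complex_manifold A \<longleftrightarrow>
     (\<forall>c\<in>A. open (fst c) \<and> open (snd c ` fst c) \<and>
        homeomorphism (fst c) (snd c ` fst c) (snd c) (chart_inv c)) \<and>
     (\<Union>c\<in>A. fst c) = UNIV \<and>
     (\<forall>c\<in>A. \<forall>c'\<in>A. \<forall>i. holo_on (snd c ` (fst c \<inter> fst c')) (\<lambda>z. snd c' (chart_inv c z) $ i))"

text \<open>Differential at \<open>x\<close> of the coordinate change from \<open>c\<close> to \<open>c'\<close>; it acts on the components of
  \<open>(1,0)\<close>-vectors with respect to the frames \<open>\<partial>\<^sub>i\<close>.\<close>

definition jac :: "('x, 'n::finite) chart \<Rightarrow> ('x, 'n) chart \<Rightarrow> 'x \<Rightarrow> complex^'n \<Rightarrow> complex^'n" where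
  "jac c c' x = frechet_derivative (\<lambda>z. snd c' (chart_inv c z)) (at (snd c x))"

text \<open>Complexified tangent vectors in a chart: \<open>v $ Inl i\<close> is the coefficient of
  \<open>\<partial>/\<partial>z\<^sub>i\<close>, and \<open>v $ Inr i\<close> that of the conjugate vector
  \<open>\<partial>/\<partial>\<close>conj\<open>(z\<^sub>i)\<close>.\<close>

type_synonym 'n ctan = "complex^('n + 'n)"

definition part10 :: "'n::finite ctan \<Rightarrow> 'n ctan" where
  "part10 v = (\<chi> k. case k of Inl i \<Rightarrow> v $ Inl i | Inr i \<Rightarrow> 0)"

definition part01 :: "'n::finite ctan \<Rightarrow> 'n ctan" where
  "part01 v = (\<chi> k. case k of Inl i \<Rightarrow> 0 | Inr i \<Rightarrow> v $ Inr i)"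

definition conj_tan :: "'n::finite ctan \<Rightarrow> 'n ctan" where
  "conj_tan v = (\<chi> k. case k of Inl i \<Rightarrow> cnj (v $ Inr i) | Inr i \<Rightarrow> cnj (v $ Inl i))"

definition push :: "('x, 'n::finite) chart \<Rightarrow> ('x, 'n) chart \<Rightarrow> 'x \<Rightarrow> 'n ctan \<Rightarrow> 'n ctan" where
  "push c c' x v = (\<chi> k. case k of
       Inl i \<Rightarrow> jac c c' x (\<chi> j. v $ Inl j) $ i
     | Inr i \<Rightarrow> cnj (jac c c' x (\<chi> j. cnj (v $ Inr j)) $ i))"

abbreviation coord_vec :: "'n::finite \<Rightarrow> 'n ctan" where
  "coord_vec i \<equiv> axis (Inl i) 1"

text \<open>Wirtinger derivatives, and the derivative along a constant complexified tangent vector.\<close>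

definition wirt :: "'n::finite \<Rightarrow> (complex^'n \<Rightarrow> complex) \<Rightarrow> complex^'n \<Rightarrow> complex" where
  "wirt i f z = (frechet_derivative f (at z) (axis i 1)
      - \<i> * frechet_derivative f (at z) (axis i \<i>)) / 2"

definition wirt_bar :: "'n::finite \<Rightarrow> (complex^'n \<Rightarrow> complex) \<Rightarrow> complex^'n \<Rightarrow> complex" where
  "wirt_bar i f z = (frechet_derivative f (at z) (axis i 1)
      + \<i> * frechet_derivative f (at z) (axis i \<i>)) / 2"

definition dir :: "'n::finite ctan \<Rightarrow> (complex^'n \<Rightarrow> complex) \<Rightarrow> complex^'n \<Rightarrow> complex" where
  "dir v f z = (\<Sum>i\<in>UNIV. v $ Inl i * wirt i f z + v $ Inr i * wirt_bar i f z)"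

definition dirv :: "'n::finite ctan \<Rightarrow> (complex^'n \<Rightarrow> complex^'m) \<Rightarrow> complex^'n \<Rightarrow> complex^'m" where
  "dirv v f z = (\<chi> j. dir v (\<lambda>w. f w $ j) z)"

definition dirm :: "'n::finite ctan \<Rightarrow> (complex^'n \<Rightarrow> complex^'m^'k) \<Rightarrow> complex^'n \<Rightarrow> complex^'m^'k" where
  "dirm v f z = (\<chi> i j. dir v (\<lambda>w. f w $ i $ j) z)"

section \<open>Holomorphic vector bundles\<close>

text \<open>The total space is the whole type \<open>'e\<close>. A local trivialization is given by its domain in the
  base and by the fibre component of the trivialization. The complex vector space structure of the
  fibres and the topology and complex structure of the total space are those making the
  trivializations isomorphisms, which the conditions on the transition matrices make consistent.\<close>

type_synonym ('x, 'e, 'r) triv = "'x set \<times> ('e \<Rightarrow> complex^'r)"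

record ('x, 'e, 'r) vbundle =
  proj :: "'e \<Rightarrow> 'x"
  trivs :: "('x, 'e, 'r) triv set"

definition fib_inv :: "('x, 'e, 'r::finite) vbundle \<Rightarrow> ('x, 'e, 'r) triv \<Rightarrow> 'x \<Rightarrow> complex^'r \<Rightarrow> 'e" where
  "fib_inv E t x = inv_into (proj E -` {x}) (snd t)"

definition trans_mat ::
  "('x, 'e, 'r::finite) vbundle \<Rightarrow> ('x, 'e, 'r) triv \<Rightarrow> ('x, 'e, 'r) triv \<Rightarrow> 'x \<Rightarrow> complex^'r^'r" where
  "trans_mat E t t' x = matrix (\<lambda>a. snd t' (fib_inv E t x a))"

definition holomorphic_vector_bundle ::
  "('x::{t2_space,second_countable_topology}, 'n::finite) chart set \<Rightarrow> ('x, 'e, 'r::finite) vbundle \<Rightarrow> bool" where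
  "holomorphic_vector_bundle A E \<longleftrightarrow>
     (\<forall>t\<in>trivs E. open (fst t) \<and> (\<forall>x\<in>fst t. bij_betw (snd t) (proj E -` {x}) UNIV)) \<and>
     (\<Union>t\<in>trivs E. fst t) = UNIV \<and>
     (\<forall>t\<in>trivs E. \<forall>t'\<in>trivs E.
        (\<forall>x\<in>fst t \<inter> fst t'. \<forall>a. snd t' (fib_inv E t x a) = trans_mat E t t' x *v a) \<and>
        (\<forall>c\<in>A. \<forall>i j. holo_on (snd c ` (fst c \<inter> fst t \<inter> fst t'))
            (\<lambda>z. trans_mat E t t' (chart_inv c z) $ i $ j)))"

text \<open>The coordinate domain on which a chart and a trivialization are both defined.\<close>

definition loc_dom :: "('x, 'n::finite) chart \<Rightarrow> ('x, 'e, 'r) triv \<Rightarrow> (complex^'n) set" where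
  "loc_dom c t = snd c ` (fst c \<inter> fst t)"

text \<open>A Hermitian metric is a function on pairs of points of the total space; only pairs in a common
  fibre matter. \<open>met\<close> is its expression in a local frame.\<close>

definition met :: "('x, 'e, 'r::finite) vbundle \<Rightarrow> ('e \<Rightarrow> 'e \<Rightarrow> complex) \<Rightarrow> ('x, 'e, 'r) triv \<Rightarrow> 'x \<Rightarrow>
    complex^'r \<Rightarrow> complex^'r \<Rightarrow> complex" where
  "met E h t x a b = h (fib_inv E t x a) (fib_inv E t x b)"

definition hermitian_metric ::
  "('x, 'n::finite) chart set \<Rightarrow> ('x, 'e, 'r::finite) vbundle \<Rightarrow> ('e \<Rightarrow> 'e \<Rightarrow> complex) \<Rightarrow> bool" where
  "hermitian_metric A E h \<longleftrightarrow> (\<forall>t\<in>trivs E.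
     (\<forall>x\<in>fst t.
        (\<forall>k a a' b. met E h t x (k *s a + a') b = k * met E h t x a b + met E h t x a' b) \<and>
        (\<forall>a b. met E h t x b a = cnj (met E h t x a b)) \<and>
        (\<forall>a. a \<noteq> 0 \<longrightarrow> Re (met E h t x a a) > 0)) \<and>
     (\<forall>c\<in>A. \<forall>a b. smooth_on (loc_dom c t) (\<lambda>z. met E h t (chart_inv c z) a b)))"

section \<open>Exterior forms\<close>

text \<open>An element of \<open>\<Lambda>\<^sup>\<bullet>V\<^sup>* \<otimes> F\<close> is a function on lists of vectors whose restriction to the
  lists of length \<open>k\<close> is an alternating \<open>k\<close>-linear map, its component of degree \<open>k\<close>. Complex-linear
  forms on the complexified tangent space are the complex-valued real forms.\<close>

type_synonym ('n, 'm) extform = "'n ctan list \<Rightarrow> complex^'m"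

definition alternating :: "('n::finite, 'm::finite) extform \<Rightarrow> bool" where
  "alternating w \<longleftrightarrow>
     (\<forall>xs ys a u v. w (xs @ (a *s u + v) # ys) = a *s w (xs @ u # ys) + w (xs @ v # ys)) \<and>
     (\<forall>xs ys zs u. w (xs @ u # ys @ u # zs) = 0)"

text \<open>\<open>w\<close> lies in the direct sum of the \<open>\<Lambda>\<^sup>p\<^sup>,\<^sup>q\<close> with \<open>(p, q) \<in> R\<close>.\<close>

definition of_type :: "(nat \<times> nat) set \<Rightarrow> ('n::finite, 'm::finite) extform \<Rightarrow> bool" where
  "of_type R w \<longleftrightarrow> (\<forall>us vs. (\<forall>u\<in>set us. part10 u = u) \<and> (\<forall>v\<in>set vs. part01 v = v) \<and>
     (length us, length vs) \<notin> R \<longrightarrow> w (us @ vs) = 0)"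

text \<open>Sign of the shuffle that lists the positions in \<open>S\<close> first, followed by the other ones.\<close>

definition shuffle_sign :: "nat \<Rightarrow> nat set \<Rightarrow> complex" where
  "shuffle_sign k S = (-1) ^ card {(i, j). i \<in> S \<and> j \<in> {..<k} - S \<and> j < i}"

definition wedge :: "('n::finite ctan list \<Rightarrow> complex) \<Rightarrow> ('n, 'm::finite) extform \<Rightarrow> ('n, 'm) extform" where
  "wedge a w vs = (\<Sum>S\<in>Pow {..<length vs}.
     shuffle_sign (length vs) S *s (a (nths vs S) *s w (nths vs (- S))))"

text \<open>\<open>i\<^sub>f w\<close> for a vector-valued form \<open>f = \<Sum>\<^sub>i f\<^sup>i \<otimes> \<partial>\<^sub>i\<close>, that is
  \<open>\<Sum>\<^sub>i f\<^sup>i \<and> (i(\<partial>\<^sub>i) w)\<close>.\<close>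

definition contract_loc :: "('n::finite, 'n) extform \<Rightarrow> ('n, 'm::finite) extform \<Rightarrow> ('n, 'm) extform" where
  "contract_loc f w = (\<Sum>i\<in>UNIV. wedge (\<lambda>vs. f vs $ i) (\<lambda>vs. w (coord_vec i # vs)))"

text \<open>Antisymmetrization of a derivative \<open>D\<close> along constant vector fields:
  \<open>(v\<^sub>0, \<dots>, v\<^sub>k) \<mapsto> \<Sum>\<^sub>i (-1)\<^sup>i D\<^bsub>v\<^sub>i\<^esub> (w(v\<^sub>0, \<dots>, v\<^sub>k))\<close>, with \<open>v\<^sub>i\<close> omitted from the arguments of \<open>w\<close>.
  It is \<open>d\<close> for the directional derivative, and \<open>d + \<theta>\<and>\<close> for \<open>D\<^sub>v + \<theta>(v)\<close>.\<close>

definition alt_deriv ::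
  "('n::finite ctan \<Rightarrow> (complex^'n \<Rightarrow> complex^'m) \<Rightarrow> complex^'n \<Rightarrow> complex^'m) \<Rightarrow>
   (complex^'n \<Rightarrow> ('n, 'm::finite) extform) \<Rightarrow> complex^'n \<Rightarrow> ('n, 'm) extform" where
  "alt_deriv D w z vs =
     (\<Sum>i<length vs. (-1) ^ i *s D (vs ! i) (\<lambda>y. w y (take i vs @ drop (Suc i) vs)) z)"

section \<open>Bundle-valued forms and tangent-valued forms\<close>

text \<open>A form is the family of its local expressions, one for each chart and trivialization, related
  by the transformation law; the local expressions are extended by zero outside their domains, so
  that equality of forms is equality of families. \<open>forms A E R\<close> is the direct sum of the
  \<open>A\<^sup>p\<^sup>,\<^sup>q(X, E)\<close> with \<open>(p, q) \<in> R\<close>; thus \<open>A\<^sup>\<bullet>\<^sup>,\<^sup>\<bullet>(X, E)\<close> is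
  \<open>forms A E UNIV\<close>.\<close>

type_synonym ('x, 'e, 'n, 'r) eform =
  "('x, 'n) chart \<Rightarrow> ('x, 'e, 'r) triv \<Rightarrow> complex^'n \<Rightarrow> ('n, 'r) extform"

type_synonym ('x, 'n) tform = "('x, 'n) chart \<Rightarrow> complex^'n \<Rightarrow> ('n, 'n) extform"

definition forms :: "('x, 'n::finite) chart set \<Rightarrow> ('x, 'e, 'r::finite) vbundle \<Rightarrow> (nat \<times> nat) set \<Rightarrow>
    ('x, 'e, 'n, 'r) eform set" where
  "forms A E R = {w.
     (\<forall>c t z. \<not> (c \<in> A \<and> t \<in> trivs E \<and> z \<in> loc_dom c t) \<longrightarrow> w c t z = 0) \<and>
     (\<forall>c\<in>A. \<forall>t\<in>trivs E.
        (\<forall>z\<in>loc_dom c t. alternating (w c t z) \<and> of_type R (w c t z)) \<and>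
        (\<forall>vs. smooth_on (loc_dom c t) (\<lambda>z. w c t z vs))) \<and>
     (\<forall>c\<in>A. \<forall>c'\<in>A. \<forall>t\<in>trivs E. \<forall>t'\<in>trivs E. \<forall>x\<in>fst c \<inter> fst c' \<inter> fst t \<inter> fst t'. \<forall>vs.
        w c' t' (snd c' x) (map (push c c' x) vs) = trans_mat E t t' x *v w c t (snd c x) vs)}"

text \<open>Likewise for forms with values in \<open>T\<^sup>1\<^sup>,\<^sup>0\<close>, the value of \<open>f c\<close> being the vector of components
  with respect to the coordinate frame \<open>\<partial>\<^sub>i\<close> of \<open>c\<close>.\<close>

definition tforms :: "('x, 'n::finite) chart set \<Rightarrow> (nat \<times> nat) set \<Rightarrow> ('x, 'n) tform set" where
  "tforms A R = {f.
     (\<forall>c z. \<not> (c \<in> A \<and> z \<in> snd c ` fst c) \<longrightarrow> f c z = 0) \<and>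
     (\<forall>c\<in>A.
        (\<forall>z\<in>snd c ` fst c. alternating (f c z) \<and> of_type R (f c z)) \<and>
        (\<forall>vs. smooth_on (snd c ` fst c) (\<lambda>z. f c z vs))) \<and>
     (\<forall>c\<in>A. \<forall>c'\<in>A. \<forall>x\<in>fst c \<inter> fst c'. \<forall>vs.
        f c' (snd c' x) (map (push c c' x) vs) = jac c c' x (f c (snd c x) vs))}"

section \<open>The Chern connection\<close>

text \<open>A connection is the family of its connection matrices: in a chart and a local frame,
  \<open>\<nabla>\<^sub>v s = D\<^sub>v s + \<theta>(v) s\<close>. The last condition of \<open>connection\<close> says that the covariant derivative
  of a section does not depend on the chart and the frame.\<close>

type_synonym ('x, 'e, 'n, 'r) conn =
  "('x, 'n) chart \<Rightarrow> ('x, 'e, 'r) triv \<Rightarrow> complex^'n \<Rightarrow> 'n ctan \<Rightarrow> complex^'r^'r"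

definition cov :: "(complex^'n \<Rightarrow> 'n::finite ctan \<Rightarrow> complex^'r^'r) \<Rightarrow>
    'n ctan \<Rightarrow> (complex^'n \<Rightarrow> complex^'r::finite) \<Rightarrow> complex^'n \<Rightarrow> complex^'r" where
  "cov th v s z = dirv v s z + th z v *v s z"

definition connection :: "('x, 'n::finite) chart set \<Rightarrow> ('x, 'e, 'r::finite) vbundle \<Rightarrow>
    ('x, 'e, 'n, 'r) conn \<Rightarrow> bool" where
  "connection A E th \<longleftrightarrow>
     (\<forall>c\<in>A. \<forall>t\<in>trivs E.
        (\<forall>z\<in>loc_dom c t. \<forall>a u v i j.
           th c t z (a *s u + v) $ i $ j = a * th c t z u $ i $ j + th c t z v $ i $ j) \<and>
        (\<forall>v. smooth_on (loc_dom c t) (\<lambda>z. th c t z v))) \<and>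
     (\<forall>c\<in>A. \<forall>c'\<in>A. \<forall>t\<in>trivs E. \<forall>t'\<in>trivs E. \<forall>x\<in>fst c \<inter> fst c' \<inter> fst t \<inter> fst t'. \<forall>v.
        dirm v (\<lambda>z. trans_mat E t t' (chart_inv c z)) (snd c x)
          + th c' t' (snd c' x) (push c c' x v) ** trans_mat E t t' x
        = trans_mat E t t' x ** th c t (snd c x) v)"

text \<open>The Chern connection: the \<open>(0,1)\<close>-part of \<open>\<nabla>\<close> is the Dolbeault operator, which acts
  componentwise in holomorphic frames, and \<open>\<nabla>\<close> is compatible with the metric,
  \<open>d h(s, s') = h(\<nabla>s, s') + h(s, \<nabla>s')\<close>. The conjugate vector in the last term comes from
  extending this identity to complexified tangent vectors.\<close>

definition chern_connection :: "('x, 'n::finite) chart set \<Rightarrow> ('x, 'e, 'r::finite) vbundle \<Rightarrow>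
    ('e \<Rightarrow> 'e \<Rightarrow> complex) \<Rightarrow> ('x, 'e, 'n, 'r) conn \<Rightarrow> bool" where
  "chern_connection A E h th \<longleftrightarrow> connection A E th \<and>
     (\<forall>c\<in>A. \<forall>t\<in>trivs E.
        (\<forall>s. smooth_on (loc_dom c t) s \<longrightarrow> (\<forall>z\<in>loc_dom c t. \<forall>v.
           cov (th c t) (part01 v) s z = dirv (part01 v) s z)) \<and>
        (\<forall>s s'. smooth_on (loc_dom c t) s \<and> smooth_on (loc_dom c t) s' \<longrightarrow>
           (\<forall>z\<in>loc_dom c t. \<forall>v.
              dir v (\<lambda>y. met E h t (chart_inv c y) (s y) (s' y)) z
              = met E h t (chart_inv c z) (cov (th c t) v s z) (s' z)
                + met E h t (chart_inv c z) (s z) (cov (th c t) (conj_tan v) s' z))))"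

section \<open>Operators on forms\<close>

definition nabla :: "('x, 'n::finite) chart set \<Rightarrow> ('x, 'e, 'r::finite) vbundle \<Rightarrow> ('x, 'e, 'n, 'r) conn \<Rightarrow>
    ('x, 'e, 'n, 'r) eform \<Rightarrow> ('x, 'e, 'n, 'r) eform" where
  "nabla A E th w c t z = (if c \<in> A \<and> t \<in> trivs E \<and> z \<in> loc_dom c t
     then alt_deriv (cov (th c t)) (w c t) z else 0)"

definition nabla10 :: "('x, 'n::finite) chart set \<Rightarrow> ('x, 'e, 'r::finite) vbundle \<Rightarrow> ('x, 'e, 'n, 'r) conn \<Rightarrow>
    ('x, 'e, 'n, 'r) eform \<Rightarrow> ('x, 'e, 'n, 'r) eform" where
  "nabla10 A E th w c t z = (if c \<in> A \<and> t \<in> trivs E \<and> z \<in> loc_dom c t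
     then alt_deriv (\<lambda>v. cov (th c t) (part10 v)) (w c t) z else 0)"

definition dbar :: "('x, 'n::finite) chart set \<Rightarrow> ('x, 'e, 'r::finite) vbundle \<Rightarrow>
    ('x, 'e, 'n, 'r) eform \<Rightarrow> ('x, 'e, 'n, 'r) eform" where
  "dbar A E w c t z = (if c \<in> A \<and> t \<in> trivs E \<and> z \<in> loc_dom c t
     then alt_deriv (\<lambda>v. dirv (part01 v)) (w c t) z else 0)"

definition dbar_tan :: "('x, 'n::finite) chart set \<Rightarrow> ('x, 'n) tform \<Rightarrow> ('x, 'n) tform" where
  "dbar_tan A f c z = (if c \<in> A \<and> z \<in> snd c ` fst c
     then alt_deriv (\<lambda>v. dirv (part01 v)) (f c) z else 0)"

text \<open>\<open>[f, g] = \<Sum>\<^sub>i\<^sub>,\<^sub>j (f\<^sup>i \<and> \<partial>\<^sub>i g\<^sup>j + g\<^sup>i \<and> \<partial>\<^sub>i f\<^sup>j) \<otimes> \<partial>\<^sub>j\<close>. Evaluating a form on constant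
  vectors before differentiating makes \<open>\<partial>\<^sub>i\<close> act on its coefficients.\<close>

definition bracket :: "('x, 'n::finite) chart set \<Rightarrow> ('x, 'n) tform \<Rightarrow> ('x, 'n) tform \<Rightarrow> ('x, 'n) tform" where
  "bracket A f g c z = (if c \<in> A \<and> z \<in> snd c ` fst c
     then (\<Sum>i\<in>UNIV.
         wedge (\<lambda>vs. f c z vs $ i) (\<lambda>vs. dirv (coord_vec i) (\<lambda>y. g c y vs) z)
       + wedge (\<lambda>vs. g c z vs $ i) (\<lambda>vs. dirv (coord_vec i) (\<lambda>y. f c y vs) z))
     else 0)"

definition half :: "('x, 'n::finite) tform \<Rightarrow> ('x, 'n) tform" where
  "half f = (\<lambda>c z vs. (1 / 2) *s f c z vs)"

definition contract :: "('x, 'n::finite) tform \<Rightarrow> ('x, 'e, 'n, 'r::finite) eform \<Rightarrow> ('x, 'e, 'n, 'r) eform" where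
  "contract f w c t z = contract_loc (f c z) (w c t z)"

definition lie :: "(('x, 'e, 'n, 'r) eform \<Rightarrow> ('x, 'e, 'n, 'r) eform) \<Rightarrow> ('x, 'n::finite) tform \<Rightarrow>
    ('x, 'e, 'n, 'r::finite) eform \<Rightarrow> ('x, 'e, 'n, 'r) eform" where
  "lie D f w = - D (contract f w) + contract f (D w)"

text \<open>The exponential series of an operator on forms, taken pointwise; for \<open>\<plusminus>i\<^sub>\<phi>\<close> with
  \<open>\<phi> \<in> A\<^sup>0\<^sup>,\<^sup>1(X, T\<^sup>1\<^sup>,\<^sup>0)\<close> only finitely many terms are nonzero.\<close>

definition exp_op :: "(('x, 'e, 'n, 'r) eform \<Rightarrow> ('x, 'e, 'n, 'r) eform) \<Rightarrow>
    ('x, 'e, 'n::finite, 'r::finite) eform \<Rightarrow> ('x, 'e, 'n, 'r) eform" where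
  "exp_op T w c t z vs = (\<Sum>k. (1 / fact k) *s (T ^^ k) w c t z vs)"

end

theory Submission
  imports Defs
begin

text \<open>Everything is local, so fix a chart and a holomorphic frame. A form \<open>\<phi>\<close> of type \<open>(0, 1)\<close> with
  values in \<open>T\<^sup>1\<^sup>,\<^sup>0\<close> is at each point a linear endomorphism \<open>\<Phi>\<close> of the complexified tangent space,
  \<open>\<Phi> v = \<phi>(v)\<close>, which kills \<open>T\<^sup>1\<^sup>,\<^sup>0\<close> and takes values in it. Hence \<open>\<Phi>\<^sub>y \<Phi>\<^sub>z = 0\<close> for any two points of
  the chart.

  The contraction \<open>i\<^sub>\<phi>\<close> substitutes \<open>\<Phi> v\<close> for one argument \<open>v\<close> at a time and adds the results
  (\<open>contract_loc_eq_slot_sum\<close>). As \<open>\<Phi>\<^sup>2 = 0\<close>, its exponential substitutes in all arguments at once: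
  \<open>e\<^sup>i\<^sup>\<phi> w = w \<circ> (1 + \<Phi>)\<close> (\<open>exp_contract_loc_sums\<close>), and \<open>e\<^sup>-\<^sup>i\<^sup>\<phi> w = w \<circ> (1 - \<Phi>)\<close>. So no
  iterated commutators occur: to compute \<open>e\<^sup>-\<^sup>i\<^sup>\<phi> \<nabla> e\<^sup>i\<^sup>\<phi> w\<close> at \<open>z\<close> one antisymmetrizes the derivatives at
  \<open>y = z\<close>, in the direction \<open>v - \<Phi>\<^sub>z v\<close>, of \<open>w\<^sub>y\<close> evaluated on the remaining vectors \<open>x\<close> moved by
  \<open>(1 + \<Phi>\<^sub>y)(1 - \<Phi>\<^sub>z) = 1 + \<Phi>\<^sub>y - \<Phi>\<^sub>z\<close>. This map is the identity at \<open>y = z\<close>, so by the Leibniz rule the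
  result is the antisymmetrization in \<open>v\<close> of
  \<open>\<nabla>\<^sub>v w - \<nabla>\<^bsub>\<Phi>v\<^esub> w + (D\<^sub>v \<Phi>) \<cdot> w - (D\<^bsub>\<Phi>v\<^esub> \<Phi>) \<cdot> w\<close>, where an endomorphism acts on \<open>w\<close> by
  substitution in one argument at a time (\<open>alt_deriv_conjugated\<close>).

  The same Leibniz rule shows that the second and third terms make up
  \<open>[\<nabla>, i\<^sub>\<phi>] = - L\<^sub>\<phi>\<close>, and, with the derivatives along \<open>(1, 0)\<close>-parts only, that
  \<open>- L\<^sub>\<phi>\<^sup>1\<^sup>,\<^sup>0\<close> comes from \<open>- \<nabla>\<^bsub>\<Phi>v\<^esub> w + (D\<^bsub>v'\<^esub> \<Phi>) \<cdot> w\<close>, with \<open>v'\<close> and \<open>v''\<close> the parts of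
  \<open>v\<close> (\<open>alt_deriv_contract_commutator\<close>). Finally \<open>1/2 [\<phi>, \<phi>]\<close> is the antisymmetrization of
  \<open>(u, v) \<mapsto> (D\<^bsub>\<Phi>u\<^esub> \<phi>) v\<close>, the Dolbeault derivative of \<open>\<phi>\<close> that of \<open>(u, v) \<mapsto> (D\<^bsub>u''\<^esub> \<phi>) v\<close>, and
  contraction with an antisymmetrized bilinear form is an antisymmetrized action on \<open>w\<close>
  (\<open>contract_loc_alt_deriv\<close>). Comparing terms gives both identities.

  For \<open>\<sigma>\<close> of type \<open>(n, q)\<close> the form \<open>\<nabla>'\<sigma>\<close> would have type \<open>(n + 1, q)\<close>, so it vanishes
  (\<open>alt_deriv_zero_of_type\<close>), and in the second identity only
  \<open>\<nabla>\<sigma> - L\<^sub>\<phi>\<^sup>1\<^sup>,\<^sup>0 \<sigma>\<close>, the Dolbeault derivative of \<open>\<sigma>\<close> plus \<open>\<nabla>'(i\<^sub>\<phi> \<sigma>)\<close>, is left.\<close>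

section \<open>Alternating sums and slot sums over lists\<close>

text \<open>The alternating sum \<open>\<Sum>\<^sub>i (-1)\<^sup>i F(v\<^sub>i, [v\<^sub>0, \<dots>, v\<^sub>k])\<close> with \<open>v\<^sub>i\<close> omitted from the list (see
  \<open>alt_sum_conv_sum\<close>). The recursive form turns the sign and index computations of exterior calculus
  into inductions on lists in which the function is generalized.\<close>

primrec alt_sum :: "'a list \<Rightarrow> ('a \<Rightarrow> 'a list \<Rightarrow> 'b::ab_group_add) \<Rightarrow> 'b" where
  "alt_sum [] F = 0"
| "alt_sum (v # vs) F = F v vs - alt_sum vs (\<lambda>x xs. F x (v # xs))"

text \<open>The action \<open>w \<mapsto> g \<cdot> w\<close> of an endomorphism on multilinear maps as a derivation, in the same
  recursive style.\<close>

primrec slot_sum :: "('a \<Rightarrow> 'a) \<Rightarrow> 'a list \<Rightarrow> ('a list \<Rightarrow> 'b::ab_group_add) \<Rightarrow> 'b" where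
  "slot_sum g [] w = 0"
| "slot_sum g (v # vs) w = w (g v # vs) + slot_sum g vs (\<lambda>xs. w (v # xs))"

lemma alt_sum_add: "alt_sum vs (\<lambda>v xs. F v xs + G v xs) = alt_sum vs F + alt_sum vs G"
  by (induction vs arbitrary: F G) (simp_all add: algebra_simps)

lemma alt_sum_minus: "alt_sum vs (\<lambda>v xs. - F v xs) = - alt_sum vs F"
  by (induction vs arbitrary: F) (simp_all add: algebra_simps)

lemma alt_sum_diff: "alt_sum vs (\<lambda>v xs. F v xs - G v xs) = alt_sum vs F - alt_sum vs G"
  by (induction vs arbitrary: F G) (simp_all add: algebra_simps)

lemma alt_sum_scale:
  fixes F :: "'a \<Rightarrow> 'a list \<Rightarrow> complex^'m"
  shows "alt_sum vs (\<lambda>v xs. c *s F v xs) = c *s alt_sum vs F"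
  by (induction vs arbitrary: F) (simp_all add: vector_ssub_ldistrib)

lemma alt_sum_zero [simp]: "alt_sum vs (\<lambda>_ _. 0) = 0"
  by (induction vs) simp_all

lemma alt_sum_sum:
  "finite I \<Longrightarrow> alt_sum vs (\<lambda>v xs. \<Sum>i\<in>I. F i v xs) = (\<Sum>i\<in>I. alt_sum vs (F i))"
  by (induction I rule: finite_induct) (simp_all add: alt_sum_add)

lemma alt_sum_map: "alt_sum (map g vs) F = alt_sum vs (\<lambda>v xs. F (g v) (map g xs))"
  by (induction vs arbitrary: F) simp_all

lemma alt_sum_append:
  fixes F :: "'a \<Rightarrow> 'a list \<Rightarrow> complex^'m"
  shows "alt_sum (xs @ ys) F =
    alt_sum xs (\<lambda>x zs. F x (zs @ ys)) + (-1) ^ length xs *s alt_sum ys (\<lambda>y zs. F y (xs @ zs))"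
  by (induction xs arbitrary: F) (simp_all add: vector_add_ldistrib)

lemma alt_sum_conv_sum:
  fixes F :: "'a \<Rightarrow> 'a list \<Rightarrow> complex^'m"
  shows "alt_sum vs F = (\<Sum>i<length vs. (-1) ^ i *s F (vs ! i) (take i vs @ drop (Suc i) vs))"
  by (induction vs arbitrary: F)
    (simp_all add: sum.lessThan_Suc_shift sum_negf del: sum.lessThan_Suc)

lemma alt_deriv_conv_alt_sum:
  "alt_deriv D w z vs = alt_sum vs (\<lambda>v xs. D v (\<lambda>y. w y xs) z)"
  by (simp add: alt_deriv_def alt_sum_conv_sum)

lemma slot_sum_add: "slot_sum g vs (\<lambda>xs. w xs + w' xs) = slot_sum g vs w + slot_sum g vs w'"
  by (induction vs arbitrary: w w') (simp_all add: algebra_simps)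

lemma slot_sum_diff: "slot_sum g vs (\<lambda>xs. w xs - w' xs) = slot_sum g vs w - slot_sum g vs w'"
  by (induction vs arbitrary: w w') (simp_all add: algebra_simps)

lemma slot_sum_scale:
  fixes w :: "'a list \<Rightarrow> complex^'m"
  shows "slot_sum g vs (\<lambda>xs. c *s w xs) = c *s slot_sum g vs w"
  by (induction vs arbitrary: w) (simp_all add: vector_add_ldistrib)

text \<open>Replacing one argument of an alternating sum: it is either the distinguished one or one of those
  left in the list.\<close>

lemma slot_sum_alt_sum:
  "slot_sum g vs (\<lambda>xs. alt_sum xs F) =
    alt_sum vs (\<lambda>v xs. F (g v) xs + slot_sum g xs (F v))"
proof (induction vs arbitrary: F)
  case (Cons v vs)
  show ?case
    by (simp add: slot_sum_diff Cons.IH alt_sum_add)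
qed simp

section \<open>Alternating forms and their types\<close>

lemma alternating_linear:
  "alternating w \<Longrightarrow> w (xs @ (a *s u + v) # ys) = a *s w (xs @ u # ys) + w (xs @ v # ys)"
  by (simp add: alternating_def)

lemma alternating_repeat: "alternating w \<Longrightarrow> w (xs @ u # ys @ u # zs) = 0"
  by (simp add: alternating_def)

lemma alternating_zero: "alternating w \<Longrightarrow> w (xs @ 0 # ys) = 0"
  using alternating_linear[of w xs 1 0 0 ys] by simp

lemma alternating_add: "alternating w \<Longrightarrow> w (xs @ (u + v) # ys) = w (xs @ u # ys) + w (xs @ v # ys)"
  using alternating_linear[of w xs 1 u v ys] by simp

lemma alternating_sum:
  assumes "alternating w" "finite I"
  shows "w (xs @ (\<Sum>i\<in>I. a i *s u i) # ys) = (\<Sum>i\<in>I. a i *s w (xs @ u i # ys))"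
  using assms(2) by (induction I rule: finite_induct) (simp_all add: assms(1) alternating_zero alternating_linear)

lemma alternating_swap:
  assumes w: "alternating w"
  shows "w (xs @ u # ys @ v # zs) = - w (xs @ v # ys @ u # zs)"
proof -
  have "0 = w (xs @ (u + v) # ys @ (u + v) # zs)"
    by (simp add: alternating_repeat[OF w])
  also have "\<dots> = w (xs @ u # ys @ (u + v) # zs) + w (xs @ v # ys @ (u + v) # zs)"
    by (rule alternating_add[OF w])
  also have "w (xs @ u # ys @ (u + v) # zs) = w (xs @ u # ys @ v # zs)"
    using alternating_add[OF w, of "xs @ u # ys" u v zs] by (simp add: alternating_repeat[OF w])
  also have "w (xs @ v # ys @ (u + v) # zs) = w (xs @ v # ys @ u # zs)"
    using alternating_add[OF w, of "xs @ v # ys" u v zs] by (simp add: alternating_repeat[OF w])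
  finally show ?thesis
    by (simp add: eq_neg_iff_add_eq_0)
qed

lemma alternating_move:
  assumes w: "alternating w"
  shows "w (xs @ ys @ u # zs) = (-1) ^ length ys *s w (xs @ u # ys @ zs)"
proof (induction ys arbitrary: xs)
  case (Cons y ys)
  have "w (xs @ (y # ys) @ u # zs) = (-1) ^ length ys *s w (xs @ y # u # ys @ zs)"
    using Cons.IH[of "xs @ [y]"] by simp
  also have "w (xs @ y # u # ys @ zs) = - w (xs @ u # y # ys @ zs)"
    using alternating_swap[OF w, of xs y "[]" u "ys @ zs"] by simp
  finally show ?case by simp
qed simp

lemma alternating_Cons: "alternating w \<Longrightarrow> alternating (\<lambda>xs. w (v # xs))"
  unfolding alternating_def
proof (elim conjE, intro conjI allI)
  fix xs ys a u x
  assume "\<forall>xs ys a u v. w (xs @ (a *s u + v) # ys) = a *s w (xs @ u # ys) + w (xs @ v # ys)"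
  from this[rule_format, of "v # xs" a u x ys]
  show "w (v # xs @ (a *s u + x) # ys) = a *s w (v # xs @ u # ys) + w (v # xs @ x # ys)" by simp
next
  fix xs ys zs u
  assume "\<forall>xs ys zs u. w (xs @ u # ys @ u # zs) = 0"
  from this[rule_format, of "v # xs" u ys zs]
  show "w (v # xs @ u # ys @ u # zs) = 0" by simp
qed

lemma alternating_scale_form: "alternating w \<Longrightarrow> alternating (\<lambda>xs. c *s w xs)"
  unfolding alternating_def by (simp add: vector_add_ldistrib mult.commute)

lemma alternating_add_form: "alternating w \<Longrightarrow> alternating w' \<Longrightarrow> alternating (\<lambda>xs. w xs + w' xs)"
  by (auto simp: alternating_def vector_add_ldistrib)

lemma alternating_map:
  assumes w: "alternating w" and g: "\<And>a u v. g (a *s u + v) = a *s g u + g v"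
  shows "alternating (\<lambda>xs. w (map g xs))"
  unfolding alternating_def map_append list.map g using w by (auto simp: alternating_def)

text \<open>Antisymmetrizing in the distinguished argument keeps a form alternating: if two arguments agree,
  only the two terms that single out one of them survive, and these cancel after moving the other
  copy across the arguments between them.\<close>

lemma alternating_alt_sum:
  assumes F: "\<And>v. alternating (F v)"
    and lin: "\<And>a u v xs. F (a *s u + v) xs = a *s F u xs + F v xs"
  shows "alternating (\<lambda>vs. alt_sum vs F)"
  unfolding alternating_def
proof (intro conjI allI)
  fix xs ys :: "'a ctan list" and a u v
  show "alt_sum (xs @ (a *s u + v) # ys) F = a *s alt_sum (xs @ u # ys) F + alt_sum (xs @ v # ys) F"
  proof -
    have 1: "F x (zs @ (a *s u + v) # ys) = a *s F x (zs @ u # ys) + F x (zs @ v # ys)" for x zs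
      by (rule alternating_linear[OF F])
    show ?thesis
      by (simp add: alt_sum_append 1 lin alternating_linear[OF F] alt_sum_add alt_sum_scale)
        (simp add: algebra_simps vector_add_ldistrib vector_ssub_ldistrib)
  qed
next
  fix xs ys zs :: "'a ctan list" and u
  have 0: "F x (as @ u # ys @ u # zs) = 0" "F x (xs @ u # as @ u # zs) = 0"
    "F x (xs @ u # ys @ u # as) = 0" for x as
    by (simp_all add: alternating_repeat[OF F])
  have "F u (xs @ ys @ u # zs) = (-1) ^ length ys *s F u (xs @ u # ys @ zs)"
    by (rule alternating_move[OF F])
  then show "alt_sum (xs @ u # ys @ u # zs) F = 0"
    by (simp add: alt_sum_append 0 vector_ssub_ldistrib)
qed

text \<open>The sign \<open>(-1)\<^sup>i\<close> is what moving the first argument back to position \<open>i\<close> costs.\<close>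

lemma alt_sum_subst_eq_slot_sum:
  assumes "alternating w"
  shows "alt_sum vs (\<lambda>v xs. w (g v # xs)) = slot_sum g vs w"
  using assms
proof (induction vs arbitrary: w)
  case (Cons v vs)
  have "w (g x # v # xs) = - w (v # g x # xs)" for x xs
    using alternating_swap[OF Cons.prems, of "[]" "g x" "[]" v xs] by simp
  then show ?case
    using Cons.IH[OF alternating_Cons[OF Cons.prems, of v]] by (simp add: alt_sum_minus)
qed simp

abbreviation coord_vec_bar :: "'n::finite \<Rightarrow> 'n ctan" where
  "coord_vec_bar i \<equiv> axis (Inr i) 1"

text \<open>The condition \<open>of_type\<close> only speaks of lists whose \<open>(1, 0)\<close>-vectors come first. By multilinearity
  and antisymmetry these lists determine the form.\<close>

lemma alternating_eq_0_if_zero_on_sorted_basis: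
  fixes w :: "('n::finite, 'm::finite) extform"
  assumes w: "alternating w"
    and 0: "\<And>us vs. set us \<subseteq> range coord_vec \<Longrightarrow> set vs \<subseteq> range coord_vec_bar \<Longrightarrow>
      length us + length vs = length xs \<Longrightarrow> w (us @ vs) = 0"
  shows "w xs = 0"
proof -
  \<comment> \<open>The arguments are expanded in the basis from left to right; \<open>us @ vs\<close> is the part already sorted.\<close>
  have "w (us @ vs @ ys) = 0"
    if "set us \<subseteq> range coord_vec" "set vs \<subseteq> range coord_vec_bar"
      "length us + length vs + length ys = length xs" for us vs ys
    using that
  proof (induction ys arbitrary: us vs)
    case Nil
    then show ?case using 0 by simp
  next
    case (Cons y ys)
    have "w (us @ vs @ axis k 1 # ys) = 0" for k :: "'n + 'n"
    proof (cases k)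
      case (Inl i)
      have "w ((us @ [coord_vec i]) @ vs @ ys) = 0"
        using Cons.prems by (intro Cons.IH) auto
      with Inl show ?thesis
        using alternating_move[OF w, of us vs "coord_vec i" ys] by simp
    next
      case (Inr i)
      have "w (us @ (vs @ [coord_vec_bar i]) @ ys) = 0"
        using Cons.prems by (intro Cons.IH) auto
      with Inr show ?thesis by simp
    qed
    moreover have "w (us @ vs @ y # ys) = (\<Sum>k\<in>UNIV. y $ k *s w (us @ vs @ axis k 1 # ys))"
      using alternating_sum[OF w, of UNIV "us @ vs" "\<lambda>k. y $ k" "\<lambda>k. axis k 1" ys]
      by (simp add: basis_expansion)
    ultimately show ?case by simp
  qed
  from this[of "[]" "[]"] show ?thesis by simp
qed

lemma part10_coord_vec [simp]: "part10 (coord_vec i) = coord_vec i"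
  by (auto simp: part10_def vec_eq_iff axis_def split: sum.splits)

lemma part01_coord_vec_bar [simp]: "part01 (coord_vec_bar i) = coord_vec_bar i"
  by (auto simp: part01_def vec_eq_iff axis_def split: sum.splits)

lemma part10_coord_vec_bar [simp]: "part10 (coord_vec_bar i) = 0"
  by (auto simp: part10_def vec_eq_iff axis_def split: sum.splits)

lemma of_type_basis:
  assumes "of_type R w" "set us \<subseteq> range coord_vec" "set vs \<subseteq> range coord_vec_bar"
    "(length us, length vs) \<notin> R"
  shows "w (us @ vs) = 0"
proof -
  have "\<forall>u\<in>set us. part10 u = u" "\<forall>v\<in>set vs. part01 v = v"
    using assms(2,3) by auto
  then show ?thesis using assms(1,4) by (simp add: of_type_def)
qed

lemma of_type_01_length:
  assumes "alternating w" "of_type {(0, 1)} w" "length xs \<noteq> 1"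
  shows "w xs = 0"
  using assms(1)
  by (rule alternating_eq_0_if_zero_on_sorted_basis) (use assms in \<open>auto intro!: of_type_basis\<close>)

section \<open>Wedge products\<close>

lemma Pow_lessThan_Suc: "Pow {..<Suc n} = image Suc ` Pow {..<n} \<union> (\<lambda>S. insert 0 (Suc ` S)) ` Pow {..<n}"
proof -
  have "Pow (Suc ` {..<n}) = image Suc ` Pow {..<n}"
    by (simp add: image_Pow_surj)
  then show ?thesis
    by (simp add: lessThan_Suc_eq_insert_0 Pow_insert image_image)
qed

text \<open>Each of the shifted positions gains one inversion, with the new position \<open>0\<close> that is not chosen.\<close>

lemma shuffle_sign_Suc:
  assumes "S \<subseteq> {..<n}"
  shows "shuffle_sign (Suc n) (Suc ` S) = (-1) ^ card S * shuffle_sign n S"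
proof -
  let ?I = "{(i, j). i \<in> S \<and> j \<in> {..<n} - S \<and> j < i}"
  have fin: "finite S" using assms finite_subset by blast
  have finI: "finite ?I"
    by (rule finite_subset[of _ "S \<times> {..<n}"]) (use fin in auto)
  have "{(i, j). i \<in> Suc ` S \<and> j \<in> {..<Suc n} - Suc ` S \<and> j < i}
      = (\<lambda>i. (Suc i, 0)) ` S \<union> map_prod Suc Suc ` ?I"
  proof (rule set_eqI)
    fix p :: "nat \<times> nat"
    obtain i j where p: "p = (i, j)" by (cases p)
    show "p \<in> {(i, j). i \<in> Suc ` S \<and> j \<in> {..<Suc n} - Suc ` S \<and> j < i} \<longleftrightarrow>
        p \<in> (\<lambda>i. (Suc i, 0)) ` S \<union> map_prod Suc Suc ` ?I"
      unfolding p by (cases i; cases j) (auto simp: image_iff)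
  qed
  moreover have "card ((\<lambda>i. (Suc i, 0::nat)) ` S \<union> map_prod Suc Suc ` ?I) = card S + card ?I"
    using fin finI by (subst card_Un_disjoint) (auto simp: card_image inj_on_def)
  ultimately show ?thesis
    by (simp add: shuffle_sign_def power_add)
qed

lemma shuffle_sign_insert_0:
  "shuffle_sign (Suc n) (insert 0 (Suc ` S)) = shuffle_sign n S"
proof -
  have "{(i, j). i \<in> insert 0 (Suc ` S) \<and> j \<in> {..<Suc n} - insert 0 (Suc ` S) \<and> j < i}
      = map_prod Suc Suc ` {(i, j). i \<in> S \<and> j \<in> {..<n} - S \<and> j < i}"
  proof (rule set_eqI)
    fix p :: "nat \<times> nat"
    obtain i j where p: "p = (i, j)" by (cases p)
    show "p \<in> {(i, j). i \<in> insert 0 (Suc ` S) \<and> j \<in> {..<Suc n} - insert 0 (Suc ` S) \<and> j < i} \<longleftrightarrow>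
        p \<in> map_prod Suc Suc ` {(i, j). i \<in> S \<and> j \<in> {..<n} - S \<and> j < i}"
      unfolding p by (cases i; cases j) (auto simp: image_iff)
  qed
  then show ?thesis
    by (simp add: shuffle_sign_def card_image inj_on_def)
qed

lemma wedge_Nil: "wedge a w [] = a [] *s w []"
  by (simp add: wedge_def shuffle_sign_def)

text \<open>Split the shuffles by whether the first vector goes to \<open>a\<close> or to \<open>w\<close>; in the latter case it passes
  all arguments of \<open>a\<close>. With this recursion, wedge products with forms of low degree are computed
  without further work on subsets.\<close>

lemma wedge_Cons:
  "wedge a w (v # vs) = wedge (\<lambda>xs. a (v # xs)) w vs
    + wedge (\<lambda>xs. (-1) ^ length xs * a xs) (\<lambda>xs. w (v # xs)) vs"
proof -
  let ?n = "length vs"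
  let ?t = "\<lambda>S. shuffle_sign (Suc ?n) S *s (a (nths (v # vs) S) *s w (nths (v # vs) (- S)))"
  have inj: "inj_on (image Suc) (Pow {..<?n})" "inj_on (\<lambda>S. insert 0 (Suc ` S)) (Pow {..<?n})"
    by (auto simp: inj_on_def inj_image_eq_iff insert_ident)
  have "wedge a w (v # vs) = sum ?t (image Suc ` Pow {..<?n}) + sum ?t ((\<lambda>S. insert 0 (Suc ` S)) ` Pow {..<?n})"
    unfolding wedge_def length_Cons Pow_lessThan_Suc by (rule sum.union_disjoint) auto
  also have "sum ?t (image Suc ` Pow {..<?n}) = wedge (\<lambda>xs. (-1) ^ length xs * a xs) (\<lambda>xs. w (v # xs)) vs"
    unfolding wedge_def sum.reindex[OF inj(1)] o_def
  proof (rule sum.cong[OF refl])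
    fix S assume S: "S \<in> Pow {..<?n}"
    then have "{i. i < ?n \<and> i \<in> S} = S" by auto
    with S show "?t (Suc ` S) = shuffle_sign ?n S *s (((-1) ^ length (nths vs S) * a (nths vs S)) *s w (v # nths vs (- S)))"
      by (simp add: nths_Cons shuffle_sign_Suc length_nths inj_image_mem_iff Compl_eq mult.assoc mult.left_commute)
  qed
  also have "sum ?t ((\<lambda>S. insert 0 (Suc ` S)) ` Pow {..<?n}) = wedge (\<lambda>xs. a (v # xs)) w vs"
    unfolding wedge_def sum.reindex[OF inj(2)] o_def
    by (rule sum.cong[OF refl]) (simp add: nths_Cons shuffle_sign_insert_0 inj_image_mem_iff Compl_eq)
  finally show ?thesis by (simp add: add.commute)
qed

lemma wedge_zero [simp]: "wedge (\<lambda>_. 0) w vs = 0"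
  by (simp add: wedge_def)

lemma wedge_minus: "wedge (\<lambda>xs. - a xs) w vs = - wedge a w vs"
  by (simp add: wedge_def sum_negf)

lemma wedge_degree_0:
  assumes "\<And>xs. xs \<noteq> [] \<Longrightarrow> a xs = 0"
  shows "wedge a w vs = a [] *s w vs"
proof (induction vs arbitrary: w)
  case (Cons v vs)
  have "(\<lambda>xs. (-1) ^ length xs * a xs) = a"
  proof
    show "(-1) ^ length xs * a xs = a xs" for xs using assms[of xs] by (cases xs) auto
  qed
  then show ?case by (simp add: wedge_Cons assms Cons.IH)
qed (simp add: wedge_Nil)

lemma wedge_degree_1:
  assumes "\<And>xs. length xs \<noteq> 1 \<Longrightarrow> a xs = 0"
  shows "wedge a w vs = alt_sum vs (\<lambda>v xs. a [v] *s w xs)"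
proof (induction vs arbitrary: w)
  case (Cons v vs)
  have "(\<lambda>xs. (-1) ^ length xs * a xs) = (\<lambda>xs. - a xs)"
  proof
    show "(-1) ^ length xs * a xs = - a xs" for xs using assms[of xs] by (cases "length xs = 1") auto
  qed
  moreover have "wedge (\<lambda>xs. a (v # xs)) w vs = a [v] *s w vs"
    by (rule wedge_degree_0) (simp add: assms)
  ultimately show ?case by (simp add: wedge_Cons wedge_minus Cons.IH)
qed (simp add: wedge_Nil assms)

text \<open>The two orders of a pair of arguments in the double alternating sum come with opposite signs, so
  they combine to the antisymmetrization of \<open>c\<close>.\<close>

lemma wedge_degree_2:
  assumes deg: "\<And>xs. length xs \<noteq> 2 \<Longrightarrow> a xs = 0"
    and a: "\<And>u v. a [u, v] = c u v - c v u"
  shows "wedge a w vs = alt_sum vs (\<lambda>u xs. alt_sum xs (\<lambda>v ys. c u v *s w ys))"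
proof (induction vs arbitrary: w)
  case (Cons v vs)
  have "(\<lambda>xs. (-1) ^ length xs * a xs) = a"
  proof
    show "(-1) ^ length xs * a xs = a xs" for xs using deg[of xs] by (cases "length xs = 2") auto
  qed
  moreover have "wedge (\<lambda>xs. a (v # xs)) w vs = alt_sum vs (\<lambda>x xs. (c v x - c x v) *s w xs)"
    by (subst wedge_degree_1) (auto simp: deg a)
  ultimately show ?case
    by (simp add: wedge_Cons Cons.IH alt_sum_diff vector_sub_rdistrib)
qed (simp add: wedge_Nil deg)

section \<open>Contraction and its exponential\<close>

text \<open>The \<open>(1, 0)\<close>-vector with given components in the coordinate frame.\<close>

definition vec10 :: "complex^'n \<Rightarrow> 'n::finite ctan" where
  "vec10 a = (\<chi> k. case k of Inl i \<Rightarrow> a $ i | Inr i \<Rightarrow> 0)"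

lemma vec10_nth [simp]: "vec10 a $ Inl i = a $ i" "vec10 a $ Inr i = 0"
  by (simp_all add: vec10_def)

lemma ctan_eqI:
  fixes u v :: "'n::finite ctan"
  assumes "\<And>i. u $ Inl i = v $ Inl i" "\<And>i. u $ Inr i = v $ Inr i"
  shows "u = v"
  unfolding vec_eq_iff by (metis assms sum.exhaust)

lemma part_nth [simp]: "part10 v $ Inl i = v $ Inl i" "part10 v $ Inr i = 0"
    "part01 v $ Inl i = 0" "part01 v $ Inr i = v $ Inr i"
  by (simp_all add: part10_def part01_def)

lemma vec10_linear: "vec10 (a *s u + v) = a *s vec10 u + vec10 v"
  by (rule ctan_eqI) auto

lemma vec10_diff: "vec10 (u - v) = vec10 u - vec10 v"
  by (rule ctan_eqI) auto

lemma vec10_minus: "vec10 (- v) = - vec10 v"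
  by (rule ctan_eqI) auto

lemma vec10_zero [simp]: "vec10 0 = 0"
  by (rule ctan_eqI) auto

lemma part10_vec10 [simp]: "part10 (vec10 a) = vec10 a"
  by (rule ctan_eqI) auto

lemma part10_linear: "part10 (a *s u + v) = a *s part10 u + part10 v"
  by (rule ctan_eqI) auto

lemma part10_plus_part01: "part10 v + part01 v = v"
  by (rule ctan_eqI) auto

lemma vec10_eq_sum: "vec10 a = (\<Sum>i\<in>UNIV. a $ i *s coord_vec i)"
  by (rule ctan_eqI) (auto simp: axis_def if_distrib cong: if_cong)

lemma sum_fun_apply: "(\<Sum>i\<in>I. F i) x = (\<Sum>i\<in>I. F i x)"
  by (induction I rule: infinite_finite_induct) auto

lemma alternating_vec10:
  assumes "alternating w"
  shows "(\<Sum>i\<in>UNIV. a $ i *s w (coord_vec i # xs)) = w (vec10 a # xs)"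
  using alternating_sum[OF assms, of UNIV "[]" "\<lambda>i. a $ i" coord_vec xs]
  by (simp add: vec10_eq_sum)

lemma contract_loc_degree_1:
  assumes "\<And>xs. length xs \<noteq> 1 \<Longrightarrow> f xs = 0" and "alternating w"
  shows "contract_loc f w vs = alt_sum vs (\<lambda>v xs. w (vec10 (f [v]) # xs))"
  by (simp add: contract_loc_def sum_fun_apply wedge_degree_1 assms(1)
      flip: alt_sum_sum alternating_vec10[OF assms(2)])

lemma contract_loc_degree_2:
  assumes "\<And>xs. length xs \<noteq> 2 \<Longrightarrow> f xs = 0" and "\<And>u v. f [u, v] = c u v - c v u"
    and "alternating w"
  shows "contract_loc f w vs = alt_sum vs (\<lambda>u xs. slot_sum (\<lambda>v. vec10 (c u v)) xs w)"
proof -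
  have "wedge (\<lambda>vs. f vs $ i) (\<lambda>vs. w (coord_vec i # vs)) vs =
      alt_sum vs (\<lambda>u xs. alt_sum xs (\<lambda>v ys. c u v $ i *s w (coord_vec i # ys)))" for i
    by (rule wedge_degree_2) (simp_all add: assms)
  then show ?thesis
    by (simp add: contract_loc_def sum_fun_apply alternating_vec10[OF assms(3)]
        alt_sum_subst_eq_slot_sum[OF assms(3), symmetric]
      flip: alt_sum_sum)
qed

lemma contract_loc_minus: "- contract_loc f w = contract_loc (\<lambda>xs. - f xs) w"
  by (rule ext) (simp add: contract_loc_def sum_fun_apply wedge_minus sum_negf)

lemma wedge_zero_right [simp]: "wedge a (\<lambda>_. 0) = (\<lambda>_. 0)"
  by (rule ext) (simp add: wedge_def)

lemma contract_loc_zero_right [simp]: "contract_loc f 0 = 0"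
  by (rule ext) (simp add: contract_loc_def sum_fun_apply)

lemma contract_loc_zero_left [simp]: "contract_loc 0 w = 0"
  by (rule ext) (simp add: contract_loc_def sum_fun_apply)

text \<open>The values at a point of the elements of \<open>A\<^sup>0\<^sup>,\<^sup>1(X, T\<^sup>1\<^sup>,\<^sup>0)\<close>.\<close>

definition tan01 :: "('n::finite, 'n) extform \<Rightarrow> bool" where
  "tan01 f \<longleftrightarrow> alternating f \<and> of_type {(0, 1)} f"

lemma tan01_degree: "tan01 f \<Longrightarrow> length xs \<noteq> 1 \<Longrightarrow> f xs = 0"
  by (simp add: tan01_def of_type_01_length)

lemma tan01_linear: "tan01 f \<Longrightarrow> f [a *s u + v] = a *s f [u] + f [v]"
  using alternating_linear[of f "[]" a u v "[]"] by (simp add: tan01_def)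

lemma tan01_diff: "tan01 f \<Longrightarrow> f [u - v] = f [u] - f [v]"
  using tan01_linear[of f "-1" v u] by simp

text \<open>This is the reason for \<open>\<Phi>\<^sub>y \<Phi>\<^sub>z = 0\<close>.\<close>

lemma tan01_vec10: "tan01 f \<Longrightarrow> f [vec10 a] = 0"
  unfolding tan01_def of_type_def
  by (elim conjE allE[of _ "[vec10 a]"] allE[of _ "[]"]) simp

lemma tan01_minus: "tan01 f \<Longrightarrow> tan01 (\<lambda>xs. - f xs)"
  using alternating_scale_form[of f "-1"] by (auto simp: tan01_def of_type_def)

lemma contract_loc_eq_slot_sum:
  assumes "tan01 f" "alternating w"
  shows "contract_loc f w = (\<lambda>vs. slot_sum (\<lambda>v. vec10 (f [v])) vs w)"
  by (rule ext)
    (simp add: assms contract_loc_degree_1 tan01_degree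
      flip: alt_sum_subst_eq_slot_sum[OF assms(2), where g = "\<lambda>v. vec10 (f [v])"])

lemma alternating_contract_loc:
  assumes "tan01 f" "alternating w"
  shows "alternating (contract_loc f w)"
proof -
  have "contract_loc f w = (\<lambda>vs. alt_sum vs (\<lambda>v xs. w (vec10 (f [v]) # xs)))"
    by (rule ext) (simp add: assms contract_loc_degree_1 tan01_degree)
  moreover have "alternating (\<lambda>vs. alt_sum vs (\<lambda>v xs. w (vec10 (f [v]) # xs)))"
  proof (rule alternating_alt_sum)
    show "alternating (\<lambda>xs. w (vec10 (f [v]) # xs))" for v
      by (rule alternating_Cons[OF assms(2)])
    show "w (vec10 (f [a *s u + v]) # xs) = a *s w (vec10 (f [u]) # xs) + w (vec10 (f [v]) # xs)" for a u v xs
      using alternating_linear[OF assms(2), of "[]"]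
      by (simp add: tan01_linear[OF assms(1)] vec10_linear)
  qed
  ultimately show ?thesis by simp
qed

lemma slot_sum_map_diff:
  assumes "alternating w"
  shows "slot_sum (\<lambda>x. g x - g' x) vs w = slot_sum g vs w - slot_sum g' vs w"
proof -
  have "w ((g x - g' x) # xs) = w (g x # xs) - w (g' x # xs)" for x xs
    using alternating_linear[OF assms, of "[]" "-1" "g' x" "g x" xs] by simp
  then show ?thesis
    by (simp add: alt_sum_diff flip: alt_sum_subst_eq_slot_sum[OF assms])
qed

lemma alternating_contract_loc_pow:
  assumes f: "tan01 f"
  shows "alternating w \<Longrightarrow> alternating ((contract_loc f ^^ k) w)"
  by (induction k) (simp_all add: alternating_contract_loc f)

text \<open>An argument in the image of \<open>\<Phi>\<close> is not affected by further contractions, as \<open>\<Phi>\<^sup>2 = 0\<close>.\<close>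

lemma contract_loc_pow_vec10:
  assumes f: "tan01 f" and w: "alternating w"
  shows "(contract_loc f ^^ k) w (vec10 a # vs) = (contract_loc f ^^ k) (\<lambda>xs. w (vec10 a # xs)) vs"
proof (induction k arbitrary: vs)
  case (Suc k)
  have alt: "alternating ((contract_loc f ^^ k) w)"
    "alternating ((contract_loc f ^^ k) (\<lambda>xs. w (vec10 a # xs)))"
    by (simp_all add: alternating_contract_loc_pow f w alternating_Cons)
  then show ?case
    using alternating_zero[OF alt(1), of "[]" vs]
    by (simp add: contract_loc_eq_slot_sum[OF f] tan01_vec10[OF f] Suc.IH)
qed simp

text \<open>Among \<open>k\<close> successive substitutions at most one concerns the first argument, as \<open>\<Phi>\<^sup>2 = 0\<close>, and it
  can be any of the \<open>k\<close> steps.\<close>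

lemma contract_loc_pow_Cons:
  assumes f: "tan01 f" and w: "alternating w"
  shows "(contract_loc f ^^ k) w (v # vs) = (contract_loc f ^^ k) (\<lambda>xs. w (v # xs)) vs
    + of_nat k *s (contract_loc f ^^ (k - 1)) (\<lambda>xs. w (vec10 (f [v]) # xs)) vs"
proof (induction k arbitrary: vs)
  case (Suc k)
  let ?T = "contract_loc f" and ?g = "\<lambda>v. vec10 (f [v])"
  have alt: "alternating ((?T ^^ j) w)" "alternating ((?T ^^ j) (\<lambda>xs. w (u # xs)))" for j u
    by (simp_all add: alternating_contract_loc_pow f w alternating_Cons)
  have "(?T ^^ Suc k) w (v # vs) = (?T ^^ k) w (?g v # vs) + slot_sum ?g vs (\<lambda>xs. (?T ^^ k) w (v # xs))"
    by (simp add: contract_loc_eq_slot_sum[OF f alt(1)])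
  also have "(?T ^^ k) w (?g v # vs) = (?T ^^ k) (\<lambda>xs. w (?g v # xs)) vs"
    by (rule contract_loc_pow_vec10[OF f w])
  also have "slot_sum ?g vs (\<lambda>xs. (?T ^^ k) w (v # xs)) = (?T ^^ Suc k) (\<lambda>xs. w (v # xs)) vs
      + of_nat k *s ?T ((?T ^^ (k - 1)) (\<lambda>xs. w (?g v # xs))) vs"
    by (simp add: Suc.IH slot_sum_add slot_sum_scale contract_loc_eq_slot_sum[OF f alt(2)])
  also have "of_nat k *s ?T ((?T ^^ (k - 1)) (\<lambda>xs. w (?g v # xs))) vs = of_nat k *s (?T ^^ k) (\<lambda>xs. w (?g v # xs)) vs"
    by (cases k) simp_all
  finally show ?case
    by (simp add: vector_sadd_rdistrib)
qed simp

text \<open>Induction on the number of arguments: dividing \<open>contract_loc_pow_Cons\<close> by \<open>k!\<close> gives the exponential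
  series for \<open>w(v, \<dots>)\<close> plus the shifted one for \<open>w(\<Phi> v, \<dots>)\<close>, and \<open>w\<close> is additive in its first
  argument.\<close>

lemma exp_contract_loc_sums:
  assumes f: "tan01 f"
  shows "alternating w \<Longrightarrow>
    (\<lambda>k. (1 / fact k) *s (contract_loc f ^^ k) w vs) sums w (map (\<lambda>v. v + vec10 (f [v])) vs)"
proof (induction vs arbitrary: w)
  case Nil
  have "(contract_loc f ^^ Suc k) w [] = 0" for k
    by (simp add: contract_loc_eq_slot_sum[OF f alternating_contract_loc_pow[OF f Nil]])
  then show ?case
    using sums_Suc[of "\<lambda>k. (1 / fact k) *s (contract_loc f ^^ k) w []" 0] by simp
next
  case (Cons v vs)
  let ?T = "contract_loc f" and ?g = "\<lambda>v. vec10 (f [v])"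
  let ?b = "\<lambda>k. (1 / fact k) *s (of_nat k *s (?T ^^ (k - 1)) (\<lambda>xs. w (?g v # xs)) vs)"
  have "(1 / fact (Suc k)) * of_nat (Suc k) = (1 / fact k :: complex)" for k
    by (simp del: of_nat_Suc)
  then have "?b (Suc k) = (1 / fact k) *s (?T ^^ k) (\<lambda>xs. w (?g v # xs)) vs" for k
    by (simp add: vector_smult_assoc del: of_nat_Suc fact_Suc)
  then have "(\<lambda>k. ?b (Suc k)) sums w (?g v # map (\<lambda>v. v + ?g v) vs)"
    using Cons.IH[OF alternating_Cons[OF Cons.prems]] by simp
  then have "?b sums w (?g v # map (\<lambda>v. v + ?g v) vs)"
    using sums_Suc[of ?b] by simp
  from sums_add[OF Cons.IH[OF alternating_Cons[OF Cons.prems, of v]] this]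
  show ?case
    using alternating_add[OF Cons.prems, of "[]" v "?g v" "map (\<lambda>v. v + ?g v) vs"]
    by (simp add: contract_loc_pow_Cons[OF f Cons.prems] vector_add_ldistrib)
qed

section \<open>Derivatives along constant vector fields\<close>

lemma has_derivative_cong_nhds:
  fixes f g :: "'a::real_normed_vector \<Rightarrow> 'b::real_normed_vector"
  assumes "\<forall>\<^sub>F y in nhds z. f y = g y"
  shows "(f has_derivative F) (at z) \<longleftrightarrow> (g has_derivative F) (at z)"
proof -
  have "(f has_derivative F) (at z) \<Longrightarrow> (g has_derivative F) (at z)"
    if "\<forall>\<^sub>F y in nhds z. f y = g y" for f g :: "'a \<Rightarrow> 'b"
    using eventually_nhds_x_imp_x[OF that] that
    by (auto simp: eventually_at_filter elim: eventually_mono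
        intro!: has_derivative_transform_eventually[of f F z UNIV g])
  from this[of f g] this[of g f] show ?thesis
    using assms by (auto simp: eq_commute)
qed

lemma differentiable_cong:
  fixes f g :: "'a::real_normed_vector \<Rightarrow> 'b::real_normed_vector"
  assumes "\<forall>\<^sub>F y in nhds z. f y = g y"
  shows "f differentiable (at z) \<longleftrightarrow> g differentiable (at z)"
  by (simp add: differentiable_def has_derivative_cong_nhds[OF assms])

lemma frechet_derivative_cong:
  fixes f g :: "'a::real_normed_vector \<Rightarrow> 'b::real_normed_vector"
  assumes "\<forall>\<^sub>F y in nhds z. f y = g y"
  shows "frechet_derivative f (at z) = frechet_derivative g (at z)"
  by (simp add: frechet_derivative_def has_derivative_cong_nhds[OF assms])

lemma dir_cong: "\<forall>\<^sub>F y in nhds z. f y = g y \<Longrightarrow> dir v f z = dir v g z"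
  by (simp add: dir_def wirt_def wirt_bar_def frechet_derivative_cong)

lemma dir_linear: "dir (a *s u + v) f z = a * dir u f z + dir v f z"
  by (simp add: dir_def sum_distrib_left flip: sum.distrib) (simp add: algebra_simps)

lemma dir_const [simp]: "dir v (\<lambda>_. c) z = 0"
  by (simp add: dir_def wirt_def wirt_bar_def)

lemma dir_mult:
  assumes "f differentiable (at z)" "g differentiable (at z)"
  shows "dir v (\<lambda>y. f y * g y) z = dir v f z * g z + f z * dir v g z"
proof -
  let ?F = "frechet_derivative f (at z)" and ?G = "frechet_derivative g (at z)"
  have "((\<lambda>y. f y * g y) has_derivative (\<lambda>h. f z * ?G h + ?F h * g z)) (at z)"
    using assms by (intro has_derivative_mult) (simp_all add: frechet_derivative_works)
  then have "frechet_derivative (\<lambda>y. f y * g y) (at z) = (\<lambda>h. f z * ?G h + ?F h * g z)"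
    by (rule frechet_derivative_at[symmetric])
  then have "wirt i (\<lambda>y. f y * g y) z = wirt i f z * g z + f z * wirt i g z"
    "wirt_bar i (\<lambda>y. f y * g y) z = wirt_bar i f z * g z + f z * wirt_bar i g z" for i
    by (simp_all add: wirt_def wirt_bar_def) (simp_all add: field_simps)
  then show ?thesis
    by (simp add: dir_def sum_distrib_left sum_distrib_right flip: sum.distrib)
      (simp add: algebra_simps)
qed

lemma dir_add:
  assumes "f differentiable (at z)" "g differentiable (at z)"
  shows "dir v (\<lambda>y. f y + g y) z = dir v f z + dir v g z"
proof -
  let ?F = "frechet_derivative f (at z)" and ?G = "frechet_derivative g (at z)"
  have "((\<lambda>y. f y + g y) has_derivative (\<lambda>h. ?F h + ?G h)) (at z)"
    using assms by (intro has_derivative_add) (simp_all add: frechet_derivative_works)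
  then have "frechet_derivative (\<lambda>y. f y + g y) (at z) = (\<lambda>h. ?F h + ?G h)"
    by (rule frechet_derivative_at[symmetric])
  then have "wirt i (\<lambda>y. f y + g y) z = wirt i f z + wirt i g z"
    "wirt_bar i (\<lambda>y. f y + g y) z = wirt_bar i f z + wirt_bar i g z" for i
    by (simp_all add: wirt_def wirt_bar_def) (simp_all add: field_simps)
  then show ?thesis
    by (simp add: dir_def flip: sum.distrib) (simp add: algebra_simps)
qed

lemma differentiable_nth:
  "f differentiable (at z) \<Longrightarrow> (\<lambda>y. f y $ j) differentiable (at z)"
  using bounded_linear.has_derivative[OF bounded_linear_vec_nth, of f]
  unfolding differentiable_def by blast

lemma bounded_bilinear_scale: "bounded_bilinear (\<lambda>(k::complex) (v::complex^'m::finite). k *s v)"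
proof
  show "\<exists>K. \<forall>a (b::complex^'m). norm (a *s b) \<le> norm a * norm b * K"
    by (rule exI[of _ 1]) (simp add: norm_vec_def norm_mult flip: L2_set_right_distrib)
qed (vector algebra_simps scaleR_conv_of_real)+

lemma differentiable_scale:
  fixes f :: "'a::real_normed_vector \<Rightarrow> complex^'m::finite"
  shows "k differentiable (at z) \<Longrightarrow> f differentiable (at z) \<Longrightarrow> (\<lambda>y. k y *s f y) differentiable (at z)"
  using bounded_bilinear.FDERIV[OF bounded_bilinear_scale]
  unfolding differentiable_def by blast

lemma dirv_cong: "\<forall>\<^sub>F y in nhds z. f y = g y \<Longrightarrow> dirv v f z = dirv v g z"
  by (auto simp: dirv_def vec_eq_iff intro!: dir_cong elim: eventually_mono)

lemma dirv_linear: "dirv (a *s u + v) f z = a *s dirv u f z + dirv v f z"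
  by (simp add: dirv_def vec_eq_iff dir_linear)

lemma dirv_diff_direction: "dirv (u - v) f z = dirv u f z - dirv v f z"
  using dirv_linear[of "-1" v u f z] by simp

lemma dirv_const [simp]: "dirv v (\<lambda>_. c) z = 0"
  by (simp add: dirv_def vec_eq_iff)

lemma dirv_add:
  "f differentiable (at z) \<Longrightarrow> g differentiable (at z) \<Longrightarrow>
    dirv v (\<lambda>y. f y + g y) z = dirv v f z + dirv v g z"
  by (simp add: dirv_def vec_eq_iff dir_add differentiable_nth)

lemma dirv_scale:
  "k differentiable (at z) \<Longrightarrow> f differentiable (at z) \<Longrightarrow>
    dirv v (\<lambda>y. k y *s f y) z = dir v k z *s f z + k z *s dirv v f z"
  by (simp add: dirv_def vec_eq_iff dir_mult differentiable_nth)

lemma dirv_vec10: "dirv (vec10 a) f z = (\<Sum>i\<in>UNIV. a $ i *s dirv (coord_vec i) f z)"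
proof -
  have 0: "dirv 0 f z = 0" using dirv_diff_direction[of 0 0 f z] by simp
  have "dirv (\<Sum>i\<in>I. a $ i *s coord_vec i) f z = (\<Sum>i\<in>I. a $ i *s dirv (coord_vec i) f z)" if "finite I" for I
    using that by induction (simp_all add: 0 dirv_linear)
  then show ?thesis by (simp add: vec10_eq_sum)
qed

section \<open>Leibniz rules for form-valued functions\<close>

text \<open>What the three operators \<open>\<nabla>\<close>, \<open>\<nabla>'\<close> and the Dolbeault operator have in common at a point: \<open>D\<^sub>v\<close>
  obeys the Leibniz rule over the derivative along \<open>L v\<close>, where \<open>L\<close> is the identity or the
  projection to one of the types.\<close>

definition derivation_at :: "complex^'n \<Rightarrow> ('n::finite ctan \<Rightarrow> 'n ctan) \<Rightarrow>
    ('n ctan \<Rightarrow> (complex^'n \<Rightarrow> complex^'m) \<Rightarrow> complex^'n \<Rightarrow> complex^'m::finite) \<Rightarrow> bool" where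
  "derivation_at z L D \<longleftrightarrow>
     (\<forall>a u v s. D (a *s u + v) s z = a *s D u s z + D v s z) \<and>
     (\<forall>v s s'. (\<forall>\<^sub>F y in nhds z. s y = s' y) \<longrightarrow> D v s z = D v s' z) \<and>
     (\<forall>v s s'. s differentiable (at z) \<longrightarrow> s' differentiable (at z) \<longrightarrow>
        D v (\<lambda>y. s y + s' y) z = D v s z + D v s' z) \<and>
     (\<forall>v k s. k differentiable (at z) \<longrightarrow> s differentiable (at z) \<longrightarrow>
        D v (\<lambda>y. k y *s s y) z = dir (L v) k z *s s z + k z *s D v s z)"

text \<open>A form defined near \<open>z\<close> with just the regularity that first derivatives at \<open>z\<close> call for, so that
  inductions in which arguments are absorbed into the form have little to check.\<close>

definition regular_form_at :: "complex^'n \<Rightarrow> (complex^'n \<Rightarrow> ('n::finite, 'm::finite) extform) \<Rightarrow> bool" where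
  "regular_form_at z w \<longleftrightarrow>
     (\<forall>\<^sub>F y in nhds z. alternating (w y)) \<and> (\<forall>xs. (\<lambda>y. w y xs) differentiable (at z))"

lemma regular_form_at_alternating: "regular_form_at z w \<Longrightarrow> alternating (w z)"
  unfolding regular_form_at_def by (blast dest: eventually_nhds_x_imp_x)

lemma regular_form_at_differentiable: "regular_form_at z w \<Longrightarrow> (\<lambda>y. w y xs) differentiable (at z)"
  by (simp add: regular_form_at_def)

lemma regular_form_at_Cons: "regular_form_at z w \<Longrightarrow> regular_form_at z (\<lambda>y xs. w y (v # xs))"
  by (auto simp: regular_form_at_def intro: alternating_Cons elim: eventually_mono)

lemma regular_form_at_add:
  "regular_form_at z w \<Longrightarrow> regular_form_at z w' \<Longrightarrow> regular_form_at z (\<lambda>y xs. w y xs + w' y xs)"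
  by (auto simp: regular_form_at_def intro: alternating_add_form differentiable_add elim: eventually_elim2)

lemma regular_form_at_cong:
  assumes w: "regular_form_at z w" and ev: "\<forall>\<^sub>F y in nhds z. w y = w' y"
  shows "regular_form_at z w'"
proof -
  have "\<forall>\<^sub>F y in nhds z. alternating (w y)"
    using w by (simp add: regular_form_at_def)
  with ev have "\<forall>\<^sub>F y in nhds z. alternating (w' y)"
    by eventually_elim simp
  moreover have "(\<lambda>y. w' y xs) differentiable (at z)" for xs
  proof -
    have "\<forall>\<^sub>F y in nhds z. w y xs = w' y xs"
      using ev by (auto elim: eventually_mono)
    from differentiable_cong[OF this] show ?thesis
      using w by (simp add: regular_form_at_def)
  qed
  ultimately show ?thesis
    by (simp add: regular_form_at_def)
qed

lemma regular_form_at_scale: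
  "k differentiable (at z) \<Longrightarrow> regular_form_at z w \<Longrightarrow> regular_form_at z (\<lambda>y xs. k y *s w y xs)"
  by (auto simp: regular_form_at_def intro: alternating_scale_form differentiable_scale elim: eventually_mono)

lemma regular_form_at_zero: "regular_form_at z (\<lambda>_ _. 0)"
  by (simp add: regular_form_at_def alternating_def)

lemma regular_form_at_sum:
  "finite I \<Longrightarrow> (\<And>i. regular_form_at z (w i)) \<Longrightarrow> regular_form_at z (\<lambda>y xs. \<Sum>i\<in>I. w i y xs)"
  by (induction I rule: finite_induct) (simp_all add: regular_form_at_zero regular_form_at_add)

text \<open>Inserting a variable vector is, near \<open>z\<close>, a combination of the forms with a constant coordinate
  vector inserted, with differentiable coefficients.\<close>

lemma regular_form_at_insert:
  assumes w: "regular_form_at z w" and f: "f differentiable (at z)"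
  shows "regular_form_at z (\<lambda>y xs. w y (vec10 (f y) # xs))"
proof (rule regular_form_at_cong)
  show "regular_form_at z (\<lambda>y xs. \<Sum>i\<in>UNIV. f y $ i *s w y (coord_vec i # xs))"
    by (intro regular_form_at_sum regular_form_at_scale regular_form_at_Cons w differentiable_nth f) simp
  show "\<forall>\<^sub>F y in nhds z. (\<lambda>xs. \<Sum>i\<in>UNIV. f y $ i *s w y (coord_vec i # xs)) = (\<lambda>xs. w y (vec10 (f y) # xs))"
    using w unfolding regular_form_at_def
    by (auto elim!: eventually_mono simp: alternating_vec10)
qed

lemma regular_form_at_insert_add:
  assumes w: "regular_form_at z w" and f: "f differentiable (at z)"
  shows "regular_form_at z (\<lambda>y xs. w y ((v + vec10 (f y)) # xs))"
proof (rule regular_form_at_cong)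
  show "regular_form_at z (\<lambda>y xs. w y (v # xs) + w y (vec10 (f y) # xs))"
    by (intro regular_form_at_add regular_form_at_Cons regular_form_at_insert w f)
  show "\<forall>\<^sub>F y in nhds z. (\<lambda>xs. w y (v # xs) + w y (vec10 (f y) # xs)) = (\<lambda>xs. w y ((v + vec10 (f y)) # xs))"
    using w unfolding regular_form_at_def
    by (auto elim!: eventually_mono simp: alternating_add[where xs = "[]", simplified])
qed

lemma regular_form_at_map:
  assumes f: "\<forall>\<^sub>F y in nhds z. tan01 (f y)" "\<And>xs. (\<lambda>y. f y xs) differentiable (at z)"
    and w: "regular_form_at z w"
  shows "regular_form_at z (\<lambda>y xs. w y (map (\<lambda>v. v + vec10 (f y [v])) xs))"
proof -
  have "(\<lambda>y. w y (map (\<lambda>v. v + vec10 (f y [v])) xs)) differentiable (at z)" for xs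
    using w
  proof (induction xs arbitrary: w)
    case Nil
    then show ?case by (simp add: regular_form_at_differentiable)
  next
    case (Cons v xs)
    show ?case
      using Cons.IH[OF regular_form_at_insert_add[OF Cons.prems f(2)[of "[v]"], of v]] by simp
  qed
  moreover have "\<forall>\<^sub>F y in nhds z. alternating (w y)"
    using w by (simp add: regular_form_at_def)
  with f(1) have "\<forall>\<^sub>F y in nhds z. alternating (\<lambda>xs. w y (map (\<lambda>v. v + vec10 (f y [v])) xs))"
    by eventually_elim
      (rule alternating_map, assumption, simp add: tan01_linear vec10_linear vector_add_ldistrib)
  ultimately show ?thesis
    by (simp add: regular_form_at_def)
qed

context
  fixes D :: "'n::finite ctan \<Rightarrow> (complex^'n \<Rightarrow> complex^'m) \<Rightarrow> complex^'n \<Rightarrow> complex^'m::finite"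
    and z :: "complex^'n" and L
  assumes D: "derivation_at z L D"
begin

lemma derivation_linear: "D (a *s u + v) s z = a *s D u s z + D v s z"
  using D by (simp add: derivation_at_def)

lemma derivation_diff_direction: "D (u - v) s z = D u s z - D v s z"
  using derivation_linear[of "-1" v u s] by simp

lemma derivation_cong: "\<forall>\<^sub>F y in nhds z. s y = s' y \<Longrightarrow> D v s z = D v s' z"
  using D by (simp add: derivation_at_def)

lemma derivation_add:
  "s differentiable (at z) \<Longrightarrow> s' differentiable (at z) \<Longrightarrow>
    D v (\<lambda>y. s y + s' y) z = D v s z + D v s' z"
  using D by (simp add: derivation_at_def)

lemma derivation_scale:
  "k differentiable (at z) \<Longrightarrow> s differentiable (at z) \<Longrightarrow>
    D v (\<lambda>y. k y *s s y) z = dir (L v) k z *s s z + k z *s D v s z"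
  using D by (simp add: derivation_at_def)

lemma derivation_zero: "D v (\<lambda>_. 0) z = 0"
  using derivation_add[of "\<lambda>_. 0" "\<lambda>_. 0" v] by simp

lemma derivation_sum:
  "finite I \<Longrightarrow> (\<And>i. s i differentiable (at z)) \<Longrightarrow> D v (\<lambda>y. \<Sum>i\<in>I. s i y) z = (\<Sum>i\<in>I. D v (s i) z)"
  by (induction I rule: finite_induct) (simp_all add: derivation_zero derivation_add differentiable_sum)

text \<open>Multilinearity and the vanishing on repeated arguments hold near \<open>z\<close>, so they can be
  differentiated.\<close>

lemma alternating_derivation:
  assumes "regular_form_at z w"
  shows "alternating (\<lambda>xs. D v (\<lambda>y. w y xs) z)"
  unfolding alternating_def
proof (intro conjI allI)
  fix xs ys a u u'
  have "D v (\<lambda>y. w y (xs @ (a *s u + u') # ys)) z = D v (\<lambda>y. a *s w y (xs @ u # ys) + w y (xs @ u' # ys)) z"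
    using assms unfolding regular_form_at_def
    by (intro derivation_cong) (auto elim!: eventually_mono simp: alternating_linear)
  also have "\<dots> = a *s D v (\<lambda>y. w y (xs @ u # ys)) z + D v (\<lambda>y. w y (xs @ u' # ys)) z"
    by (simp add: derivation_add derivation_scale differentiable_scale regular_form_at_differentiable[OF assms])
  finally show "D v (\<lambda>y. w y (xs @ (a *s u + u') # ys)) z
      = a *s D v (\<lambda>y. w y (xs @ u # ys)) z + D v (\<lambda>y. w y (xs @ u' # ys)) z" .
next
  fix xs ys zs u
  have "D v (\<lambda>y. w y (xs @ u # ys @ u # zs)) z = D v (\<lambda>_. 0) z"
    using assms unfolding regular_form_at_def
    by (intro derivation_cong) (auto elim!: eventually_mono simp: alternating_repeat)
  then show "D v (\<lambda>y. w y (xs @ u # ys @ u # zs)) z = 0"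
    by (simp add: derivation_zero)
qed

lemma alternating_alt_deriv:
  assumes "regular_form_at z w"
  shows "alternating (alt_deriv D w z)"
proof -
  have "alternating (\<lambda>vs. alt_sum vs (\<lambda>v xs. D v (\<lambda>y. w y xs) z))"
    by (rule alternating_alt_sum) (simp_all add: alternating_derivation assms derivation_linear)
  then show ?thesis
    by (simp add: alt_deriv_conv_alt_sum[abs_def])
qed

lemma derivation_insert:
  assumes w: "regular_form_at z w" and f: "f differentiable (at z)"
  shows "D u (\<lambda>y. w y (vec10 (f y) # xs)) z =
      D u (\<lambda>y. w y (vec10 (f z) # xs)) z + w z (vec10 (dirv (L u) f z) # xs)"
proof -
  let ?S = "\<lambda>y. \<Sum>i\<in>UNIV. f y $ i *s w y (coord_vec i # xs)"
  have diff_term: "(\<lambda>y. f y $ i *s w y (coord_vec i # xs)) differentiable (at z)" for i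
    by (intro differentiable_scale differentiable_nth f regular_form_at_differentiable[OF w])
  note alt = regular_form_at_alternating[OF w]
  have "D u (\<lambda>y. w y (vec10 (f y) # xs)) z = D u ?S z"
    using w unfolding regular_form_at_def
    by (intro derivation_cong) (auto elim!: eventually_mono simp: alternating_vec10)
  also have "\<dots> = (\<Sum>i\<in>UNIV. dirv (L u) f z $ i *s w z (coord_vec i # xs)
      + f z $ i *s D u (\<lambda>y. w y (coord_vec i # xs)) z)"
    by (simp add: derivation_sum diff_term derivation_scale differentiable_nth f regular_form_at_differentiable[OF w] dirv_def)
  also have "\<dots> = w z (vec10 (dirv (L u) f z) # xs) + D u (\<lambda>y. w y (vec10 (f z) # xs)) z"
    using alternating_vec10[OF alternating_derivation[OF w, of u], of "f z" xs]
    by (simp add: sum.distrib alternating_vec10 alt)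
  finally show ?thesis by simp
qed

lemma derivation_slot_sum:
  assumes f: "\<And>v. (\<lambda>y. f y v) differentiable (at z)"
  shows "regular_form_at z w \<Longrightarrow>
    (\<lambda>y. slot_sum (\<lambda>v. vec10 (f y v)) vs (w y)) differentiable (at z) \<and>
    D u (\<lambda>y. slot_sum (\<lambda>v. vec10 (f y v)) vs (w y)) z =
      slot_sum (\<lambda>v. vec10 (f z v)) vs (\<lambda>xs. D u (\<lambda>y. w y xs) z)
      + slot_sum (\<lambda>v. vec10 (dirv (L u) (\<lambda>y. f y v) z)) vs (w z)"
proof (induction vs arbitrary: w)
  case Nil
  then show ?case by (simp add: derivation_zero)
next
  case (Cons v vs)
  note ins = derivation_insert[OF Cons.prems f[of v]]
  note IH = Cons.IH[OF regular_form_at_Cons[OF Cons.prems, of v]]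
  show ?case
    using IH regular_form_at_differentiable[OF regular_form_at_insert[OF Cons.prems f], where xs = vs]
    by (simp add: differentiable_add derivation_add ins)
qed

text \<open>The Leibniz rule for all arguments at once, for a family of maps that is the identity at \<open>z\<close>.
  Because of the latter, no argument is changed in the terms where another one is differentiated.\<close>

lemma derivation_near_identity_map:
  assumes f: "\<And>v. (\<lambda>y. f y v) differentiable (at z)" and f0: "\<And>v. f z v = 0"
  shows "regular_form_at z w \<Longrightarrow>
    D u (\<lambda>y. w y (map (\<lambda>v. v + vec10 (f y v)) vs)) z =
      D u (\<lambda>y. w y vs) z + slot_sum (\<lambda>v. vec10 (dirv (L u) (\<lambda>y. f y v) z)) vs (w z)"
proof (induction vs arbitrary: w)
  case Nil
  then show ?case by simp
next
  case (Cons v vs)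
  note w = Cons.prems
  note ins = derivation_insert[OF w f[of v]] and reg_ins = regular_form_at_insert[OF w f[of v]]
  \<comment> \<open>The first argument is absorbed into the form, which the induction hypothesis allows to vary.\<close>
  let ?w = "\<lambda>y xs. w y (v # xs) + w y (vec10 (f y v) # xs)"
  have reg: "regular_form_at z ?w"
    by (intro regular_form_at_add regular_form_at_Cons[OF w] reg_ins)
  have wz: "?w z = (\<lambda>xs. w z (v # xs))"
    using alternating_zero[OF regular_form_at_alternating[OF w], of "[]"] by (simp add: f0)
  have zero: "D u (\<lambda>y. w y (0 # vs)) z = 0"
    using alternating_zero[OF alternating_derivation[OF w], of u "[]"] by simp
  have "D u (\<lambda>y. w y (map (\<lambda>v. v + vec10 (f y v)) (v # vs))) z
      = D u (\<lambda>y. ?w y (map (\<lambda>v. v + vec10 (f y v)) vs)) z"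
    using w unfolding regular_form_at_def
    by (intro derivation_cong) (auto elim!: eventually_mono dest: alternating_add[where xs = "[]"])
  also have "\<dots> = D u (\<lambda>y. ?w y vs) z + slot_sum (\<lambda>v. vec10 (dirv (L u) (\<lambda>y. f y v) z)) vs (?w z)"
    by (rule Cons.IH[OF reg])
  also have "D u (\<lambda>y. ?w y vs) z = D u (\<lambda>y. w y (v # vs)) z + w z (vec10 (dirv (L u) (\<lambda>y. f y v) z) # vs)"
    by (simp add: derivation_add regular_form_at_differentiable[OF w] regular_form_at_differentiable[OF reg_ins]
        ins f0 zero)
  finally show ?case
    by (simp add: wz algebra_simps)
qed

end

section \<open>Conjugation and commutator at a point\<close>

definition regular_tan01_at :: "complex^'n \<Rightarrow> (complex^'n \<Rightarrow> ('n::finite, 'n) extform) \<Rightarrow> bool" where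
  "regular_tan01_at z f \<longleftrightarrow>
     (\<forall>\<^sub>F y in nhds z. tan01 (f y)) \<and> (\<forall>xs. (\<lambda>y. f y xs) differentiable (at z))"

lemma regular_tan01_at_tan01: "regular_tan01_at z f \<Longrightarrow> tan01 (f z)"
  unfolding regular_tan01_at_def by (blast dest: eventually_nhds_x_imp_x)

lemma alt_deriv_cong:
  assumes "derivation_at z L D" "\<forall>\<^sub>F y in nhds z. w y = w' y"
  shows "alt_deriv D w z = alt_deriv D w' z"
proof -
  have "D v (\<lambda>y. w y xs) z = D v (\<lambda>y. w' y xs) z" for v xs
    by (rule derivation_cong[OF assms(1)]) (use assms(2) in \<open>auto elim: eventually_mono\<close>)
  then show ?thesis
    by (simp add: alt_deriv_def[abs_def])
qed

text \<open>Since \<open>f\<close> has degree one near \<open>z\<close>, its antisymmetrized derivative has degree two, with value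
  \<open>(D\<^bsub>K u\<^esub> f) v - (D\<^bsub>K v\<^esub> f) u\<close> on \<open>u, v\<close>. Both the Dolbeault derivative and half the bracket
  have this form, for different \<open>K\<close>.\<close>

lemma contract_loc_alt_deriv:
  assumes f: "regular_tan01_at z f" and w: "alternating w"
  shows "contract_loc (alt_deriv (\<lambda>v. dirv (K v)) f z) w vs =
    alt_sum vs (\<lambda>u xs. slot_sum (\<lambda>v. vec10 (dirv (K u) (\<lambda>y. f y [v]) z)) xs w)"
proof (rule contract_loc_degree_2[OF _ _ w])
  fix xs :: "'a ctan list"
  assume len: "length xs \<noteq> 2"
  have "dirv (K v) (\<lambda>y. f y (take i xs @ drop (Suc i) xs)) z = 0" if "i < length xs" for i v
  proof -
    have "length (take i xs @ drop (Suc i) xs) \<noteq> 1" using that len by auto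
    then have "dirv (K v) (\<lambda>y. f y (take i xs @ drop (Suc i) xs)) z = dirv (K v) (\<lambda>_. 0) z"
      using f unfolding regular_tan01_at_def
      by (intro dirv_cong) (auto elim!: eventually_mono intro: tan01_degree)
    then show ?thesis by simp
  qed
  then show "alt_deriv (\<lambda>v. dirv (K v)) f z xs = 0"
    by (simp add: alt_deriv_def)
qed (simp add: alt_deriv_conv_alt_sum)

text \<open>\<open>\<Sum>\<^sub>i f\<^sup>i(v) \<partial>\<^sub>i\<close> is the derivative along \<open>f(v)\<close>, and the two summands of the bracket agree, which
  cancels the factor \<open>1/2\<close>.\<close>

lemma half_bracket_eq_alt_deriv:
  assumes "tan01 (f z)"
  shows "(\<lambda>vs. (1 / 2) *s (\<Sum>i\<in>UNIV.
         wedge (\<lambda>vs. f z vs $ i) (\<lambda>vs. dirv (coord_vec i) (\<lambda>y. f y vs) z)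
       + wedge (\<lambda>vs. f z vs $ i) (\<lambda>vs. dirv (coord_vec i) (\<lambda>y. f y vs) z)) vs)
    = alt_deriv (\<lambda>v. dirv (vec10 (f z [v]))) f z"
proof
  fix vs
  have "wedge (\<lambda>vs. f z vs $ i) (\<lambda>vs. dirv (coord_vec i) (\<lambda>y. f y vs) z) vs
      = alt_sum vs (\<lambda>v xs. f z [v] $ i *s dirv (coord_vec i) (\<lambda>y. f y xs) z)" for i
    by (rule wedge_degree_1) (simp add: tan01_degree[OF assms])
  then have "(\<Sum>i\<in>UNIV. wedge (\<lambda>vs. f z vs $ i) (\<lambda>vs. dirv (coord_vec i) (\<lambda>y. f y vs) z) vs)
      = alt_deriv (\<lambda>v. dirv (vec10 (f z [v]))) f z vs"
    by (simp add: alt_deriv_conv_alt_sum dirv_vec10 flip: alt_sum_sum)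
  then show "(1 / 2) *s (\<Sum>i\<in>UNIV.
         wedge (\<lambda>vs. f z vs $ i) (\<lambda>vs. dirv (coord_vec i) (\<lambda>y. f y vs) z)
       + wedge (\<lambda>vs. f z vs $ i) (\<lambda>vs. dirv (coord_vec i) (\<lambda>y. f y vs) z)) vs
    = alt_deriv (\<lambda>v. dirv (vec10 (f z [v]))) f z vs"
    by (simp add: sum_fun_apply sum.distrib) (simp add: vec_eq_iff flip: sum_distrib_left)
qed

context
  fixes D :: "'n::finite ctan \<Rightarrow> (complex^'n \<Rightarrow> complex^'m) \<Rightarrow> complex^'n \<Rightarrow> complex^'m::finite"
    and z :: "complex^'n" and L
    and f :: "complex^'n \<Rightarrow> ('n, 'n) extform" and w :: "complex^'n \<Rightarrow> ('n, 'm) extform"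
  assumes D: "derivation_at z L D" and f: "regular_tan01_at z f" and w: "regular_form_at z w"
begin

text \<open>The heart of the proof: \<open>w \<circ> (1 + \<Phi>\<^sub>y)\<close> is differentiated and then evaluated on vectors moved by
  \<open>1 - \<Phi>\<^sub>z\<close>, so what is differentiated is \<open>w\<close> on vectors moved by \<open>1 + \<Phi>\<^sub>y - \<Phi>\<^sub>z\<close>.\<close>

lemma alt_deriv_conjugated:
  "alt_deriv D (\<lambda>y xs. w y (map (\<lambda>v. v + vec10 (f y [v])) xs)) z (map (\<lambda>v. v - vec10 (f z [v])) vs)
    = alt_sum vs (\<lambda>v xs. D (v - vec10 (f z [v])) (\<lambda>y. w y xs) z
        + slot_sum (\<lambda>x. vec10 (dirv (L (v - vec10 (f z [v]))) (\<lambda>y. f y [x]) z)) xs (w z))"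
proof -
  let ?M = "\<lambda>v. v - vec10 (f z [v])"
  have fz: "tan01 (f z)" by (rule regular_tan01_at_tan01[OF f])
  have diff: "(\<lambda>y. f y [v] - f z [v]) differentiable (at z)" for v
    using f by (intro differentiable_diff) (auto simp: regular_tan01_at_def)
  have dirv_f: "dirv u (\<lambda>y. f y [v] - f z [v]) z = dirv u (\<lambda>y. f y [v]) z" for u v
    using dirv_add[of "\<lambda>y. f y [v]" z "\<lambda>_. - f z [v]" u] f by (auto simp: regular_tan01_at_def)
  have "D u (\<lambda>y. w y (map (\<lambda>v. v + vec10 (f y [v])) (map ?M xs))) z
      = D u (\<lambda>y. w y (map (\<lambda>v. v + vec10 (f y [v] - f z [v])) xs)) z" for u xs
  proof (rule derivation_cong[OF D])
    show "\<forall>\<^sub>F y in nhds z. w y (map (\<lambda>v. v + vec10 (f y [v])) (map ?M xs))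
        = w y (map (\<lambda>v. v + vec10 (f y [v] - f z [v])) xs)"
      using f unfolding regular_tan01_at_def
    proof (elim conjE, elim eventually_mono)
      fix y assume "tan01 (f y)"
      then have "(\<lambda>v. v + vec10 (f y [v])) \<circ> ?M = (\<lambda>v. v + vec10 (f y [v] - f z [v]))"
        by (auto simp: tan01_diff tan01_vec10 vec10_diff)
      then show "w y (map (\<lambda>v. v + vec10 (f y [v])) (map ?M xs))
        = w y (map (\<lambda>v. v + vec10 (f y [v] - f z [v])) xs)"
        by simp
    qed
  qed
  also have "D u (\<lambda>y. w y (map (\<lambda>v. v + vec10 (f y [v] - f z [v])) xs)) z
      = D u (\<lambda>y. w y xs) z + slot_sum (\<lambda>v. vec10 (dirv (L u) (\<lambda>y. f y [v]) z)) xs (w z)" for u xs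
    using derivation_near_identity_map[OF D diff _ w, where u = u and vs = xs] by (simp add: dirv_f)
  finally show ?thesis
    by (simp add: alt_deriv_conv_alt_sum alt_sum_map del: map_map)
qed

text \<open>In \<open>D (i\<^sub>f w) - i\<^sub>f (D w)\<close> the terms in which \<open>D\<close> and \<open>\<Phi>\<close> act on different arguments and \<open>D\<close>
  differentiates \<open>w\<close> cancel. What is left are the derivatives of \<open>\<Phi>\<close> and the terms where \<open>\<Phi>\<close> is
  applied to the direction of differentiation.\<close>

lemma alt_deriv_contract_commutator:
  "alt_deriv D (\<lambda>y. contract_loc (f y) (w y)) z vs - contract_loc (f z) (alt_deriv D w z) vs
    = alt_sum vs (\<lambda>v xs. slot_sum (\<lambda>x. vec10 (dirv (L v) (\<lambda>y. f y [x]) z)) xs (w z)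
        - D (vec10 (f z [v])) (\<lambda>y. w y xs) z)"
proof -
  have fz: "tan01 (f z)" by (rule regular_tan01_at_tan01[OF f])
  have ev: "\<forall>\<^sub>F y in nhds z. contract_loc (f y) (w y) = (\<lambda>xs. slot_sum (\<lambda>v. vec10 (f y [v])) xs (w y))"
  proof -
    have "\<forall>\<^sub>F y in nhds z. tan01 (f y)" "\<forall>\<^sub>F y in nhds z. alternating (w y)"
      using f w by (auto simp: regular_tan01_at_def regular_form_at_def)
    then show ?thesis
      by eventually_elim (rule contract_loc_eq_slot_sum)
  qed
  have "alt_deriv D (\<lambda>y. contract_loc (f y) (w y)) z vs
      = alt_sum vs (\<lambda>v xs. slot_sum (\<lambda>x. vec10 (f z [x])) xs (\<lambda>ys. D v (\<lambda>y. w y ys) z)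
          + slot_sum (\<lambda>x. vec10 (dirv (L v) (\<lambda>y. f y [x]) z)) xs (w z))"
    unfolding alt_deriv_cong[OF D ev] alt_deriv_conv_alt_sum
    using derivation_slot_sum[OF D _ w, of "\<lambda>y v. f y [v]"] f by (simp add: regular_tan01_at_def)
  moreover have "contract_loc (f z) (alt_deriv D w z) vs
      = alt_sum vs (\<lambda>v xs. D (vec10 (f z [v])) (\<lambda>y. w y xs) z
          + slot_sum (\<lambda>x. vec10 (f z [x])) xs (\<lambda>ys. D v (\<lambda>y. w y ys) z))"
    by (simp only: contract_loc_eq_slot_sum[OF fz alternating_alt_deriv[OF D w]])
      (simp add: alt_deriv_conv_alt_sum[abs_def] slot_sum_alt_sum)
  ultimately show ?thesis
    by (simp add: alt_sum_add alt_sum_diff)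
qed

end

text \<open>On a sorted list of basis vectors with \<open>n + 1\<close> vectors of type \<open>(1, 0)\<close> two arguments agree. With
  any other number of them, each term either differentiates along a \<open>(0, 1)\<close>-vector or differentiates
  a coefficient of \<open>w\<close> of a type that does not occur.\<close>

lemma alt_deriv_zero_of_type:
  fixes w :: "complex^'n \<Rightarrow> ('n::finite, 'm::finite) extform"
  assumes D: "derivation_at z part10 D" and w: "regular_form_at z w"
    and ty: "\<forall>\<^sub>F y in nhds z. of_type ({CARD('n)} \<times> UNIV) (w y)"
    and D01: "\<And>v s. part10 v = 0 \<Longrightarrow> D v s z = 0"
  shows "alt_deriv D w z = 0"
proof
  fix xs
  have alt: "alternating (alt_deriv D w z)"
    by (rule alternating_alt_deriv[OF D w])
  show "alt_deriv D w z xs = 0 xs"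
    unfolding zero_fun_apply
  proof (rule alternating_eq_0_if_zero_on_sorted_basis[OF alt])
    fix us vs :: "'n ctan list"
    assume us: "set us \<subseteq> range coord_vec" and vs: "set vs \<subseteq> range coord_vec_bar"
    show "alt_deriv D w z (us @ vs) = 0"
    proof (cases "length us = Suc (CARD('n))")
      case True
      have "card (set us) \<le> CARD('n)"
        using card_mono[OF _ us] card_image_le[of UNIV "coord_vec :: 'n \<Rightarrow> _"] by simp
      with True have "\<not> distinct us"
        using distinct_card[of us] by auto
      then obtain as bs cs u where "us = as @ [u] @ bs @ [u] @ cs"
        using not_distinct_decomp by blast
      then show ?thesis
        using alternating_repeat[OF alt, of as u bs "cs @ vs"] by simp
    next
      case False
      have "D ((us @ vs) ! i) (\<lambda>y. w y (take i (us @ vs) @ drop (Suc i) (us @ vs))) z = 0"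
        if i: "i < length (us @ vs)" for i
      proof (cases "i < length us")
        case True
        let ?us = "take i us @ drop (Suc i) us"
        have len: "length ?us \<noteq> CARD('n)" using True False by auto
        have "set ?us \<subseteq> range coord_vec"
          using us set_take_subset[of i us] set_drop_subset[of "Suc i" us] by auto
        with vs len have "D v (\<lambda>y. w y (?us @ vs)) z = D v (\<lambda>_. 0) z" for v
          by (intro derivation_cong[OF D] eventually_mono[OF ty] of_type_basis) auto
        with True show ?thesis by (simp add: derivation_zero[OF D])
      next
        case False
        then have "(us @ vs) ! i \<in> set vs" using i by (simp add: nth_append)
        with vs show ?thesis by (intro D01) auto
      qed
      then show ?thesis by (simp add: alt_deriv_def)
    qed
  qed
qed

section \<open>From local expressions to the manifold\<close>

lemma smooth_on_differentiable: "smooth_on S f \<Longrightarrow> x \<in> S \<Longrightarrow> f differentiable (at x)"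
  unfolding smooth_on_def by (metis ck_on.simps(2))

lemma smooth_on_const: "smooth_on S (\<lambda>_. c)"
proof -
  have "ck_on k (\<lambda>_. c) S" for k
    by (induction k arbitrary: c) simp_all
  then show ?thesis by (simp add: smooth_on_def)
qed

lemma open_chart_image:
  assumes "complex_manifold A" "c \<in> A" "open U"
  shows "open (snd c ` (fst c \<inter> U))"
proof -
  have hom: "homeomorphism (fst c) (snd c ` fst c) (snd c) (chart_inv c)"
    and op: "open (snd c ` fst c)"
    using assms by (auto simp: complex_manifold_def)
  have "openin (top_of_set (snd c ` fst c)) (snd c ` (fst c \<inter> U))"
    by (rule homeomorphism_imp_open_map[OF hom]) (simp add: assms(3) openin_open_Int)
  then show ?thesis
    using op openin_open_trans by blast
qed

lemma open_loc_dom: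
  assumes "complex_manifold A" "holomorphic_vector_bundle A E" "c \<in> A" "t \<in> trivs E"
  shows "open (loc_dom c t)"
proof -
  have "open (fst t)" using assms by (auto simp: holomorphic_vector_bundle_def)
  then show ?thesis
    using assms by (simp add: loc_dom_def open_chart_image)
qed

lemma forms_outside: "\<alpha> \<in> forms A E R \<Longrightarrow> \<not> (c \<in> A \<and> t \<in> trivs E \<and> z \<in> loc_dom c t) \<Longrightarrow> \<alpha> c t z = 0"
  unfolding forms_def by blast

lemma funpow_contract:
  "(contract \<phi> ^^ k) \<alpha> c t z = (contract_loc (\<phi> c z) ^^ k) (\<alpha> c t z)"
  by (induction k) (simp_all add: contract_def)

lemma funpow_minus_contract:
  "((- contract \<phi>) ^^ k) \<alpha> c t z = (contract_loc (\<lambda>xs. - \<phi> c z xs) ^^ k) (\<alpha> c t z)"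
proof (induction k)
  case (Suc k)
  have "(- contract \<phi>) \<beta> c t z = contract_loc (\<lambda>xs. - \<phi> c z xs) (\<beta> c t z)" for \<beta>
    by (simp add: contract_def flip: contract_loc_minus)
  from this[of "((- contract \<phi>) ^^ k) \<alpha>"] show ?case
    unfolding funpow.simps o_apply Suc.IH .
qed simp

lemma exp_op_contract:
  assumes "tan01 (\<phi> c z)" "alternating (\<alpha> c t z)"
  shows "exp_op (contract \<phi>) \<alpha> c t z = (\<lambda>vs. \<alpha> c t z (map (\<lambda>v. v + vec10 (\<phi> c z [v])) vs))"
  by (rule ext)
    (simp add: exp_op_def funpow_contract sums_unique[OF exp_contract_loc_sums[OF assms], symmetric])

lemma exp_op_minus_contract:
  assumes "tan01 (\<phi> c z)" "alternating (\<alpha> c t z)"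
  shows "exp_op (- contract \<phi>) \<alpha> c t z = (\<lambda>vs. \<alpha> c t z (map (\<lambda>v. v - vec10 (\<phi> c z [v])) vs))"
  by (rule ext)
    (simp add: exp_op_def funpow_minus_contract vec10_minus
      sums_unique[OF exp_contract_loc_sums[OF tan01_minus[OF assms(1)] assms(2)], symmetric])

lemma funpow_contract_loc_zero: "(contract_loc f ^^ k) 0 = 0"
  by (induction k) (simp_all only: funpow.simps o_apply id_apply contract_loc_zero_right)

lemma exp_op_minus_contract_zero:
  assumes "\<alpha> c t z = 0"
  shows "exp_op (- contract \<phi>) \<alpha> c t z = 0"
  by (intro ext) (simp add: exp_op_def funpow_minus_contract assms funpow_contract_loc_zero)

lemma derivation_at_cov:
  assumes th: "\<And>a u v i j. th z (a *s u + v) $ i $ j = a * th z u $ i $ j + th z v $ i $ j"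
    and L: "\<And>a u v. L (a *s u + v) = a *s L u + L v"
  shows "derivation_at z L (\<lambda>v. cov th (L v))"
proof -
  have "th z (a *s u + v) *v x = a *s (th z u *v x) + th z v *v x" for a u v x
    by (simp add: vec_eq_iff matrix_vector_mult_def th)
      (simp add: sum_distrib_left algebra_simps sum.distrib)
  moreover have "cov th v s z = cov th v s' z" if "\<forall>\<^sub>F y in nhds z. s y = s' y" for v s s'
    using dirv_cong[OF that] eventually_nhds_x_imp_x[OF that] by (simp add: cov_def)
  ultimately show ?thesis
    by (auto simp: derivation_at_def cov_def L dirv_linear dirv_add dirv_scale
        matrix_vector_right_distrib vector_add_ldistrib vector_scalar_commute)
qed

context
  fixes A :: "('x::{t2_space,second_countable_topology}, 'n::finite) chart set"
    and E :: "('x, 'e, 'r::finite) vbundle"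
    and h :: "'e \<Rightarrow> 'e \<Rightarrow> complex"
    and \<theta> :: "('x, 'e, 'n, 'r) conn"
    and \<phi> :: "('x, 'n) tform"
  assumes A: "complex_manifold A"
    and E: "holomorphic_vector_bundle A E"
    and chern: "chern_connection A E h \<theta>"
    and \<phi>: "\<phi> \<in> tforms A {(0, 1)}"
begin

lemma connection_linear:
  assumes "c \<in> A" "t \<in> trivs E" "z \<in> loc_dom c t"
  shows "\<theta> c t z (a *s u + v) $ i $ j = a * \<theta> c t z u $ i $ j + \<theta> c t z v $ i $ j"
  using chern assms unfolding chern_connection_def connection_def by blast

lemma derivation_nabla:
  assumes "c \<in> A" "t \<in> trivs E" "z \<in> loc_dom c t"
  shows "derivation_at z (\<lambda>v. v) (cov (\<theta> c t))"
    and "derivation_at z part10 (\<lambda>v. cov (\<theta> c t) (part10 v))"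
  using derivation_at_cov[of "\<theta> c t" z, OF connection_linear[OF assms]]
  by (auto simp: part10_linear)

text \<open>In a holomorphic frame the Dolbeault operator acts componentwise; applied to constant sections this
  says that the connection matrix vanishes on \<open>(0, 1)\<close>-vectors.\<close>

lemma cov_split:
  assumes "c \<in> A" "t \<in> trivs E" "z \<in> loc_dom c t"
  shows "cov (\<theta> c t) v s z = cov (\<theta> c t) (part10 v) s z + dirv (part01 v) s z"
proof -
  have "\<theta> c t z (part01 v) *v x = 0" for x
  proof -
    have "cov (\<theta> c t) (part01 v) (\<lambda>_. x) z = dirv (part01 v) (\<lambda>_. x) z"
      using chern assms smooth_on_const unfolding chern_connection_def by blast
    then show ?thesis by (simp add: cov_def)
  qed
  then have "cov (\<theta> c t) (part01 v) s z = dirv (part01 v) s z"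
    by (simp add: cov_def)
  moreover have "cov (\<theta> c t) (1 *s part10 v + part01 v) s z
      = 1 *s cov (\<theta> c t) (part10 v) s z + cov (\<theta> c t) (part01 v) s z"
    by (rule derivation_linear[OF derivation_nabla(1)[OF assms]])
  ultimately show ?thesis
    by (simp add: part10_plus_part01)
qed

lemma loc_dom_subset: "loc_dom c t \<subseteq> snd c ` fst c"
  by (auto simp: loc_dom_def)

lemma tan01_local:
  assumes "c \<in> A" "z \<in> snd c ` fst c"
  shows "tan01 (\<phi> c z)"
  using \<phi> assms unfolding tforms_def tan01_def by blast

lemma regular_tan01_local:
  assumes "c \<in> A" "t \<in> trivs E" "z \<in> loc_dom c t"
  shows "regular_tan01_at z (\<phi> c)"
  unfolding regular_tan01_at_def
proof (intro conjI allI)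
  have "\<forall>\<^sub>F y in nhds z. y \<in> loc_dom c t"
    using open_loc_dom[OF A E assms(1,2)] assms(3) by (rule eventually_nhds_in_open)
  then show "\<forall>\<^sub>F y in nhds z. tan01 (\<phi> c y)"
    by (rule eventually_mono) (rule tan01_local[OF assms(1) subsetD[OF loc_dom_subset]])
  fix xs
  have "smooth_on (snd c ` fst c) (\<lambda>y. \<phi> c y xs)"
    using \<phi> assms(1) unfolding tforms_def by blast
  then show "(\<lambda>y. \<phi> c y xs) differentiable (at z)"
    by (rule smooth_on_differentiable) (rule subsetD[OF loc_dom_subset assms(3)])
qed

lemma regular_form_local:
  assumes "c \<in> A" "t \<in> trivs E" "z \<in> loc_dom c t" "\<alpha> \<in> forms A E R"
  shows "regular_form_at z (\<alpha> c t)" "\<forall>\<^sub>F y in nhds z. of_type R (\<alpha> c t y)"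
proof -
  have "\<forall>\<^sub>F y in nhds z. y \<in> loc_dom c t"
    using open_loc_dom[OF A E assms(1,2)] assms(3) by (rule eventually_nhds_in_open)
  moreover have "\<forall>y\<in>loc_dom c t. alternating (\<alpha> c t y) \<and> of_type R (\<alpha> c t y)"
    using assms unfolding forms_def by blast
  ultimately have "\<forall>\<^sub>F y in nhds z. alternating (\<alpha> c t y) \<and> of_type R (\<alpha> c t y)"
    by (auto elim: eventually_mono)
  moreover have "(\<lambda>y. \<alpha> c t y xs) differentiable (at z)" for xs
  proof -
    have "smooth_on (loc_dom c t) (\<lambda>y. \<alpha> c t y xs)"
      using assms unfolding forms_def by blast
    then show ?thesis using assms(3) by (rule smooth_on_differentiable)
  qed
  ultimately show "regular_form_at z (\<alpha> c t)" "\<forall>\<^sub>F y in nhds z. of_type R (\<alpha> c t y)"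
    by (auto simp: regular_form_at_def elim: eventually_mono)
qed

lemma half_bracket_local:
  assumes "c \<in> A" "z \<in> snd c ` fst c"
  shows "half (bracket A \<phi> \<phi>) c z = alt_deriv (\<lambda>v. dirv (vec10 (\<phi> c z [v]))) (\<phi> c) z"
  using half_bracket_eq_alt_deriv[of "\<phi> c" z] tan01_local[OF assms] assms
  by (simp add: half_def bracket_def)

lemma exp_conjugate_local:
  assumes dom: "c \<in> A" "t \<in> trivs E" "z \<in> loc_dom c t" and \<alpha>: "\<alpha> \<in> forms A E R"
  shows "exp_op (- contract \<phi>) (nabla A E \<theta> (exp_op (contract \<phi>) \<alpha>)) c t z vs
    = alt_sum vs (\<lambda>v xs. cov (\<theta> c t) (v - vec10 (\<phi> c z [v])) (\<lambda>y. \<alpha> c t y xs) z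
        + slot_sum (\<lambda>x. vec10 (dirv (v - vec10 (\<phi> c z [v])) (\<lambda>y. \<phi> c y [x]) z)) xs (\<alpha> c t z))"
proof -
  note D = derivation_nabla(1)[OF dom]
  note f = regular_tan01_local[OF dom] and w = regular_form_local(1)[OF dom \<alpha>]
  let ?w = "\<lambda>y xs. \<alpha> c t y (map (\<lambda>v. v + vec10 (\<phi> c y [v])) xs)"
  have "\<forall>\<^sub>F y in nhds z. tan01 (\<phi> c y)" "\<forall>\<^sub>F y in nhds z. alternating (\<alpha> c t y)"
    using f w by (auto simp: regular_tan01_at_def regular_form_at_def)
  then have "\<forall>\<^sub>F y in nhds z. exp_op (contract \<phi>) \<alpha> c t y = ?w y"
    by eventually_elim (rule exp_op_contract)
  then have nabla: "nabla A E \<theta> (exp_op (contract \<phi>) \<alpha>) c t z = alt_deriv (cov (\<theta> c t)) ?w z"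
    using alt_deriv_cong[OF D] dom by (simp add: nabla_def)
  have "alternating (nabla A E \<theta> (exp_op (contract \<phi>) \<alpha>) c t z)"
    unfolding nabla
    using f by (intro alternating_alt_deriv[OF D] regular_form_at_map w) (auto simp: regular_tan01_at_def)
  then show ?thesis
    using alt_deriv_conjugated[OF D f w, of vs]
    by (simp add: exp_op_minus_contract[of \<phi> c z, OF regular_tan01_at_tan01[OF f]] nabla)
qed

lemma commutator_nabla_local:
  assumes dom: "c \<in> A" "t \<in> trivs E" "z \<in> loc_dom c t" and \<alpha>: "\<alpha> \<in> forms A E R"
  shows "lie (nabla A E \<theta>) \<phi> \<alpha> c t z vs
      = - alt_sum vs (\<lambda>v xs. slot_sum (\<lambda>x. vec10 (dirv v (\<lambda>y. \<phi> c y [x]) z)) xs (\<alpha> c t z)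
          - cov (\<theta> c t) (vec10 (\<phi> c z [v])) (\<lambda>y. \<alpha> c t y xs) z)"
    and "lie (nabla10 A E \<theta>) \<phi> \<alpha> c t z vs
      = - alt_sum vs (\<lambda>v xs. slot_sum (\<lambda>x. vec10 (dirv (part10 v) (\<lambda>y. \<phi> c y [x]) z)) xs (\<alpha> c t z)
          - cov (\<theta> c t) (vec10 (\<phi> c z [v])) (\<lambda>y. \<alpha> c t y xs) z)"
  using alt_deriv_contract_commutator[OF derivation_nabla(1)[OF dom]
      regular_tan01_local[OF dom] regular_form_local(1)[OF dom \<alpha>], of vs]
    alt_deriv_contract_commutator[OF derivation_nabla(2)[OF dom]
      regular_tan01_local[OF dom] regular_form_local(1)[OF dom \<alpha>], of vs]
    dom
  by (simp_all add: lie_def nabla_def nabla10_def contract_def[abs_def] algebra_simps)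

text \<open>Each term of either identity is an alternating sum of a covariant derivative of \<open>\<alpha>\<close> (\<open>N\<close> in the
  proof) or of the action of a derivative of \<open>\<Phi>\<close> (\<open>S\<close>), in a direction that depends linearly on the
  distinguished argument. Both are additive in that direction.\<close>

lemma exp_conjugate_nabla:
  assumes \<alpha>: "\<alpha> \<in> forms A E R"
  shows "exp_op (- contract \<phi>) (nabla A E \<theta> (exp_op (contract \<phi>) \<alpha>))
    = nabla A E \<theta> \<alpha> - lie (nabla A E \<theta>) \<phi> \<alpha> - contract (half (bracket A \<phi> \<phi>)) \<alpha>" (is "?exp = ?R1")
    and "nabla A E \<theta> \<alpha> - lie (nabla A E \<theta>) \<phi> \<alpha> - contract (half (bracket A \<phi> \<phi>)) \<alpha>
      = nabla A E \<theta> \<alpha> - lie (nabla10 A E \<theta>) \<phi> \<alpha>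
        + contract (dbar_tan A \<phi> - half (bracket A \<phi> \<phi>)) \<alpha>" (is "_ = ?R2")
proof -
  have "?exp c t z vs = ?R1 c t z vs \<and> ?R1 c t z vs = ?R2 c t z vs" for c t z vs
  proof (cases "c \<in> A \<and> t \<in> trivs E \<and> z \<in> loc_dom c t")
    case False
    moreover have "\<alpha> c t z = 0" by (rule forms_outside[OF \<alpha> False])
    moreover have "nabla A E \<theta> \<beta> c t z = 0" for \<beta> by (simp only: nabla_def False if_False)
    moreover have "nabla10 A E \<theta> \<beta> c t z = 0" for \<beta> by (simp only: nabla10_def False if_False)
    ultimately show ?thesis
      by (simp add: exp_op_minus_contract_zero lie_def contract_def)
  next
    case True
    then have dom: "c \<in> A" "t \<in> trivs E" "z \<in> loc_dom c t" by auto
    have z: "z \<in> snd c ` fst c" using dom(3) loc_dom_subset by blast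
    note f = regular_tan01_local[OF dom] and w = regular_form_local(1)[OF dom \<alpha>]
    note alt = regular_form_at_alternating[OF w]
    let ?d = "\<lambda>u x. dirv u (\<lambda>y. \<phi> c y [x]) z"
    let ?\<Phi> = "\<lambda>v. vec10 (\<phi> c z [v])"
    define S where "S K = alt_sum vs (\<lambda>v xs. slot_sum (\<lambda>x. vec10 (?d (K v) x)) xs (\<alpha> c t z))" for K
    define N where "N K = alt_sum vs (\<lambda>v xs. cov (\<theta> c t) (K v) (\<lambda>y. \<alpha> c t y xs) z)" for K
    have S_diff: "S (\<lambda>v. K v - K' v) = S K - S K'" for K K'
      by (simp add: S_def dirv_diff_direction vec10_diff slot_sum_map_diff[OF alt] alt_sum_diff)
    have N_diff: "N (\<lambda>v. K v - K' v) = N K - N K'" for K K'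
      by (simp add: N_def derivation_diff_direction[OF derivation_nabla(1)[OF dom]] alt_sum_diff)
    have "S (\<lambda>v. v - part10 v) = S (\<lambda>v. v) - S part10"
      by (rule S_diff)
    moreover have "v - part10 v = part01 v" for v :: "'n ctan"
      using part10_plus_part01[of v] by (simp add: algebra_simps)
    ultimately have S01: "S part01 = S (\<lambda>v. v) - S part10"
      by simp
    have "?exp c t z vs = N (\<lambda>v. v) - N ?\<Phi> + (S (\<lambda>v. v) - S ?\<Phi>)"
      unfolding exp_conjugate_local[OF dom \<alpha>] alt_sum_add N_diff[symmetric] S_diff[symmetric]
      by (simp only: N_def S_def)
    moreover have "nabla A E \<theta> \<alpha> c t z vs = N (\<lambda>v. v)"
      using dom by (simp add: nabla_def alt_deriv_conv_alt_sum N_def)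
    moreover have "lie (nabla A E \<theta>) \<phi> \<alpha> c t z vs = N ?\<Phi> - S (\<lambda>v. v)"
      "lie (nabla10 A E \<theta>) \<phi> \<alpha> c t z vs = N ?\<Phi> - S part10"
      by (simp_all add: commutator_nabla_local[OF dom \<alpha>] alt_sum_diff N_def S_def)
    moreover have "contract (half (bracket A \<phi> \<phi>)) \<alpha> c t z vs = S ?\<Phi>"
      by (simp add: contract_def half_bracket_local[OF dom(1) z] contract_loc_alt_deriv[OF f alt] S_def)
    moreover have "contract (dbar_tan A \<phi> - half (bracket A \<phi> \<phi>)) \<alpha> c t z vs = S part01 - S ?\<Phi>"
    proof -
      have "dbar_tan A \<phi> c z - half (bracket A \<phi> \<phi>) c z = alt_deriv (\<lambda>v. dirv (part01 v - ?\<Phi> v)) (\<phi> c) z"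
        using dom z
        by (auto simp: half_bracket_local dbar_tan_def alt_deriv_conv_alt_sum dirv_diff_direction alt_sum_diff)
      then show ?thesis
        unfolding S_diff[symmetric] by (simp add: contract_def contract_loc_alt_deriv[OF f alt] S_def)
    qed
    ultimately show ?thesis
      by (simp add: S01)
  qed
  then show "?exp = ?R1" "?R1 = ?R2"
    by (auto intro!: ext)
qed

lemma nabla_eq_nabla10_plus_dbar: "nabla A E \<theta> \<alpha> = nabla10 A E \<theta> \<alpha> + dbar A E \<alpha>"
proof (intro ext)
  fix c t z vs
  show "nabla A E \<theta> \<alpha> c t z vs = (nabla10 A E \<theta> \<alpha> + dbar A E \<alpha>) c t z vs"
  proof (cases "c \<in> A \<and> t \<in> trivs E \<and> z \<in> loc_dom c t")
    case True
    then have "(\<lambda>v xs. cov (\<theta> c t) v (\<lambda>y. \<alpha> c t y xs) z) = (\<lambda>v xs.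
        cov (\<theta> c t) (part10 v) (\<lambda>y. \<alpha> c t y xs) z + dirv (part01 v) (\<lambda>y. \<alpha> c t y xs) z)"
      by (intro ext cov_split) auto
    with True show ?thesis
      by (simp add: nabla_def nabla10_def dbar_def alt_deriv_conv_alt_sum alt_sum_add)
  qed (auto simp: nabla_def nabla10_def dbar_def)
qed

lemma nabla10_top_type:
  assumes "\<sigma> \<in> forms A E ({CARD('n)} \<times> UNIV)"
  shows "nabla10 A E \<theta> \<sigma> = 0"
proof (intro ext)
  fix c t z vs
  show "nabla10 A E \<theta> \<sigma> c t z vs = 0 c t z vs"
  proof (cases "c \<in> A \<and> t \<in> trivs E \<and> z \<in> loc_dom c t")
    case True
    then have dom: "c \<in> A" "t \<in> trivs E" "z \<in> loc_dom c t" by auto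
    note D = derivation_nabla(2)[OF dom]
    have "cov (\<theta> c t) 0 s z = 0" for s
      using derivation_diff_direction[OF derivation_nabla(1)[OF dom], of 0 0 s] by simp
    then have "alt_deriv (\<lambda>v. cov (\<theta> c t) (part10 v)) (\<sigma> c t) z = 0"
      by (intro alt_deriv_zero_of_type[OF D] regular_form_local[OF dom assms]) simp
    with True show ?thesis by (simp add: nabla10_def)
  qed (auto simp: nabla10_def)
qed

end

theorem theorem1p3:
  fixes A :: "('x::{t2_space,second_countable_topology}, 'n::finite) chart set"
    and E :: "('x, 'e, 'r::finite) vbundle"
    and h :: "'e \<Rightarrow> 'e \<Rightarrow> complex"
    and \<theta> :: "('x, 'e, 'n, 'r) conn"
    and \<phi> :: "('x, 'n) tform"
  assumes "complex_manifold A"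
    and "holomorphic_vector_bundle A E"
    and "hermitian_metric A E h"
    and "chern_connection A E h \<theta>"
    and "\<phi> \<in> tforms A {(0, 1)}"
  shows "(\<forall>\<alpha>\<in>forms A E UNIV.
      (exp_op (- contract \<phi>) \<circ> nabla A E \<theta> \<circ> exp_op (contract \<phi>)) \<alpha>
        = nabla A E \<theta> \<alpha> - lie (nabla A E \<theta>) \<phi> \<alpha> - contract (half (bracket A \<phi> \<phi>)) \<alpha>
      \<and> nabla A E \<theta> \<alpha> - lie (nabla A E \<theta>) \<phi> \<alpha> - contract (half (bracket A \<phi> \<phi>)) \<alpha>
        = nabla A E \<theta> \<alpha> - lie (nabla10 A E \<theta>) \<phi> \<alpha>
            + contract (dbar_tan A \<phi> - half (bracket A \<phi> \<phi>)) \<alpha>)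
    \<and> (\<forall>\<sigma>\<in>forms A E ({CARD('n)} \<times> UNIV).
      dbar_tan A \<phi> - half (bracket A \<phi> \<phi>) = 0 \<longrightarrow>
      (exp_op (- contract \<phi>) \<circ> nabla A E \<theta> \<circ> exp_op (contract \<phi>)) \<sigma>
        = dbar A E \<sigma> + nabla10 A E \<theta> (contract \<phi> \<sigma>))"
proof (intro conjI ballI impI)
  note identities = exp_conjugate_nabla[OF assms(1,2,4,5)]
  fix \<alpha> assume "\<alpha> \<in> forms A E UNIV"
  then show "(exp_op (- contract \<phi>) \<circ> nabla A E \<theta> \<circ> exp_op (contract \<phi>)) \<alpha>
        = nabla A E \<theta> \<alpha> - lie (nabla A E \<theta>) \<phi> \<alpha> - contract (half (bracket A \<phi> \<phi>)) \<alpha>"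
    "nabla A E \<theta> \<alpha> - lie (nabla A E \<theta>) \<phi> \<alpha> - contract (half (bracket A \<phi> \<phi>)) \<alpha>
        = nabla A E \<theta> \<alpha> - lie (nabla10 A E \<theta>) \<phi> \<alpha>
            + contract (dbar_tan A \<phi> - half (bracket A \<phi> \<phi>)) \<alpha>"
    using identities by simp_all
next
  fix \<sigma> :: "('x, 'e, 'n, 'r) eform"
  assume \<sigma>: "\<sigma> \<in> forms A E ({CARD('n)} \<times> UNIV)"
    and integrable: "dbar_tan A \<phi> - half (bracket A \<phi> \<phi>) = 0"
  have "(exp_op (- contract \<phi>) \<circ> nabla A E \<theta> \<circ> exp_op (contract \<phi>)) \<sigma>
      = nabla A E \<theta> \<sigma> - lie (nabla10 A E \<theta>) \<phi> \<sigma> + contract 0 \<sigma>"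
    using exp_conjugate_nabla[OF assms(1,2,4,5) \<sigma>] integrable by simp
  also have "contract 0 \<sigma> = 0"
    by (intro ext) (simp add: contract_def)
  also have "lie (nabla10 A E \<theta>) \<phi> \<sigma> = - nabla10 A E \<theta> (contract \<phi> \<sigma>)"
    unfolding lie_def nabla10_top_type[OF assms(1,2,4,5) \<sigma>]
    by (intro ext) (simp add: contract_def)
  also have "nabla A E \<theta> \<sigma> = dbar A E \<sigma>"
    by (simp add: nabla_eq_nabla10_plus_dbar[OF assms(1,2,4,5)] nabla10_top_type[OF assms(1,2,4,5) \<sigma>])
  finally show "(exp_op (- contract \<phi>) \<circ> nabla A E \<theta> \<circ> exp_op (contract \<phi>)) \<sigma>
      = dbar A E \<sigma> + nabla10 A E \<theta> (contract \<phi> \<sigma>)"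
    by (simp only: diff_minus_eq_add add_0_right)
qed

end
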